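(* There is a randomized algorithm which, given only the vertex set $V$ ($|V|=n$) of an unknown multitree $G=(V,E)$ with $a$ roots and maximum degree bounded by a fixed constant $d$, and access to path queries on $G$, determines $E$ using $O(an\log n)$ path queries in $O(a\log n)$ parallel rounds, with high probability.
   Context: A multitree is a directed acyclic graph in which, for every ordered pair of vertices $(u,v)$, there is at most one directed path from $u$ to $v$. A root is a vertex of in-degree $0$. The degree of a vertex is its in-degree plus its out-degree. A path query $\mathsf{path}(u,v)$ returns $1$ if there is a directed path from $u$ to $v$ in $G$ and $0$ otherwise. The algorithm initially knows only $V$ and learns about $E$ only via path queries. Queries are issued in rounds: the queries in a round are issued as a batch and may depend only on answers to queries of previous rounds; the query complexity is the total number of queries and the round complexity is the number of rounds. "With high probability" means with probability at least $1-1/n^{c}$ for some constant $c\ge 1$. *)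

theory Defs
  imports
    "Graph_Theory.Pair_Digraph"
    "HOL-Probability.Probability_Mass_Function"
begin

locale multitree = pair_fin_digraph +
  assumes no_cycle: "\<nexists>p. cycle p"
    and unique_path: "apath u p v \<Longrightarrow> apath u q v \<Longrightarrow> p = q"

definition vertex_degree :: "('a, 'b) pre_digraph \<Rightarrow> 'a \<Rightarrow> nat" where
  "vertex_degree G v = in_degree G v + out_degree G v"

definition roots :: "('a, 'b) pre_digraph \<Rightarrow> 'a set" where
  "roots G = {v \<in> verts G. in_degree G v = 0}"

text \<open>
  The answer to a path query. The path of length 0 counts, so a query about a vertex and
  itself is answered positively.
\<close>
definition path_query :: "('a, 'b) pre_digraph \<Rightarrow> 'a \<times> 'a \<Rightarrow> bool" where
  "path_query G = (\<lambda>(u, v). u \<rightarrow>\<^sup>*\<^bsub>G\<^esub> v)"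

text \<open>
  Adaptive randomized algorithms over the vertex type, as well-founded decision trees.
  \<open>Sample\<close> is a random choice and costs nothing. \<open>Round\<close> issues one batch of
  queries; its continuation receives exactly the list of answers to that batch, and these answers
  are the only way in which an algorithm can gain information about the arcs.
  Running time is not modelled, only queries and rounds.
\<close>
datatype 'a query_alg =
    Output "('a \<times> 'a) set"
  | Sample "'a query_alg pmf"
  | Round "('a \<times> 'a) list" "bool list \<Rightarrow> 'a query_alg"

text \<open>
  The joint distribution of the output, the total number of queries and the number of rounds.
\<close>
primrec run :: "('a \<times> 'a \<Rightarrow> bool) \<Rightarrow> 'a query_alg \<Rightarrow> (('a \<times> 'a) set \<times> nat \<times> nat) pmf" where
  "run ans (Output A) = return_pmf (A, 0, 0)"
| "run ans (Sample P) = join_pmf (map_pmf (run ans) P)"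
| "run ans (Round qs k) =
     map_pmf (\<lambda>(A, q, r). (A, length qs + q, Suc r)) (run ans (k (map ans qs)))"

end

theory Submission
  imports Defs
begin

text \<open>
  Replacing a random vertex's ancestor set by the ancestor set of a random member halves its
  expected size, because at most half of all ordered pairs are strictly comparable. So
  \<open>O(log n)\<close> rounds lead to a root \<open>r\<close> with high probability. The descendants of \<open>r\<close> form a
  tree, which is cut recursively and in parallel: the lowest common ancestor \<open>z\<close> of two random
  vertices of a part \<open>S\<close> splits off a constant fraction of \<open>S\<close> with constant probability.
  Finding \<open>z\<close> with \<open>O(card S)\<close> queries in \<open>O(1)\<close> rounds uses that the common ancestors form a
  chain: among \<open>sqrt (card S)\<close> random vertices, the deepest one lying on the chain cuts it down
  to length \<open>sqrt (card S)\<close> with constant probability, and then all pairs can be compared. The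
  expected number of vertex pairs lying in a common part therefore decreases geometrically, and
  Markov's inequality bounds the failure probability. After removing the descendants of \<open>r\<close>,
  the remaining vertices are closed under ancestors and the process is repeated, once per root.
\<close>

section \<open>Reachability and subtrees\<close>

text \<open>Luck is needed only for progress: a cut at any vertex of a part again yields valid parts
  with known boundaries, so an unlucky pick merely leaves the potential undiminished. The obstacle
  is the budget of a level, which allows a constant number of rounds and linearly many queries. The
  common ancestors of two vertices may form a chain of linear length, and ordering it by comparing
  all its pairs would cost quadratically many queries. A square root is the size at which comparing
  all pairs is still linear, and it is just large enough for random samples to hit equally many
  deepest chain elements with constant probability. Lowest common ancestors serve as cut vertices
  because a single random vertex is typically near a leaf and separates too little. The degree bound
  guarantees a subtree that is neither too small nor too large, and it keeps the number of arcs
  leaving a part linear in the part. Trees of different roots may overlap. Each is learned in full,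
  so shared arcs are found repeatedly; this repetition is paid for by the factor \<open>a\<close> in
  the query bound.\<close>

context multitree
begin

abbreviation le (infix "\<preceq>" 50) where "u \<preceq> v \<equiv> u \<rightarrow>\<^sup>*\<^bsub>G\<^esub> v"

lemma le_verts: "u \<preceq> v \<Longrightarrow> u \<in> pverts G \<and> v \<in> pverts G"
  using reachable_in_verts by auto

lemma le_refl: "v \<in> pverts G \<Longrightarrow> v \<preceq> v"
  using reachable_refl by auto

lemma le_trans: "u \<preceq> v \<Longrightarrow> v \<preceq> w \<Longrightarrow> u \<preceq> w"
  using reachable_trans by auto

lemma arc_le: "(u, v) \<in> parcs G \<Longrightarrow> u \<preceq> v"
  using reachable_adjI by auto

lemma le_antisym:
  assumes "u \<preceq> v" "v \<preceq> u"
  shows "u = v"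
proof (rule ccontr)
  assume "u \<noteq> v"
  from assms obtain p q where pq: "awalk u p v" "awalk v q u"
    unfolding reachable_awalk by auto
  with \<open>u \<noteq> v\<close> have "awalk u (p @ q) u" "p \<noteq> []"
    by (auto simp: awalk_Nil_iff)
  then have "closed_w (p @ q)"
    unfolding closed_w_def by auto
  then show False
    using closed_w_imp_cycle no_cycle by blast
qed

lemma arc_neq: "(u, v) \<in> parcs G \<Longrightarrow> u \<noteq> v"
proof
  assume "(u, v) \<in> parcs G" "u = v"
  then have "closed_w [(u, v)]"
    unfolding closed_w_def by (auto simp: awalk_simps dest: in_arcsD1)
  then show False
    using closed_w_imp_cycle no_cycle by blast
qed

lemma le_last:
  assumes "u \<preceq> v" "u \<noteq> v"
  obtains p where "u \<preceq> p" "(p, v) \<in> parcs G"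
proof -
  have "u = v \<or> (\<exists>p. u \<preceq> p \<and> (p, v) \<in> parcs G)"
    using assms(1) by (induction rule: reachable_induct) auto
  with assms(2) that show ?thesis
    by blast
qed

lemma le_first:
  assumes "u \<preceq> v" "u \<noteq> v"
  obtains c where "(u, c) \<in> parcs G" "c \<preceq> v"
  using assms by (cases rule: converse_reachable_cases) auto

text \<open>Paths from \<open>r\<close> through two different parents would extend to two different
  simple paths from \<open>r\<close> to \<open>h\<close>. Here uniqueness of paths enters; it makes
  the descendants of \<open>r\<close> a tree although the whole graph is none.\<close>

lemma parent_unique:
  assumes "r \<preceq> p" "r \<preceq> s" "(p, h) \<in> parcs G" "(s, h) \<in> parcs G"
  shows "p = s"
proof -
  have ext: "\<exists>\<pi>. apath r (\<pi> @ [(q, h)]) h" if "r \<preceq> q" "(q, h) \<in> parcs G" for q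
  proof -
    from that obtain \<pi> where \<pi>: "apath r \<pi> q"
      unfolding reachable_apath by auto
    have "h \<notin> set (awalk_verts r \<pi>)"
    proof
      assume "h \<in> set (awalk_verts r \<pi>)"
      then have "h \<preceq> q"
        using \<pi> by (metis apath_def awalk_verts_reachable_to)
      with that show False
        using le_antisym arc_le arc_neq by blast
    qed
    with \<pi> that have "apath r (\<pi> @ [(q, h)]) h"
      by (auto simp: apath_append_iff apath_simps awlast_of_awalk dest: in_arcsD2 awalkI_apath arc_neq)
    then show ?thesis ..
  qed
  from ext[of p] ext[of s] assms unique_path show ?thesis
    by blast
qed

text \<open>Induction along the path from \<open>b\<close> to \<open>x\<close>: unless
  \<open>a\<close> is already \<open>x\<close>, a path from \<open>a\<close> must enter
  \<open>x\<close> through the same parent, because both parents are reachable from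
  \<open>r\<close>.\<close>

lemma ancestors_chain:
  assumes "r \<preceq> a" "r \<preceq> b" "a \<preceq> x" "b \<preceq> x"
  shows "a \<preceq> b \<or> b \<preceq> a"
  using assms(4,3,2)
proof (induction rule: reachable_induct)
  case base
  then show ?case by simp
next
  case (step y x)
  show ?case
  proof (cases "a = x")
    case True
    with step show ?thesis
      using arc_le le_trans by blast
  next
    case False
    then obtain p where "a \<preceq> p" "(p, x) \<in> parcs G"
      using step le_last by blast
    moreover have "p = y"
      using parent_unique[of r p y x] calculation step assms(1) le_trans by blast
    ultimately show ?thesis
      using step by blast
  qed
qed

lemma finite_verts_above: "finite {u. u \<preceq> v}"
  using le_verts by (blast intro: finite_subset[OF _ pair_finite_verts])

lemma chain_greatest:
  assumes "finite C" "C \<noteq> {}" "C \<subseteq> pverts G" "\<And>a b. a \<in> C \<Longrightarrow> b \<in> C \<Longrightarrow> a \<preceq> b \<or> b \<preceq> a"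
  shows "\<exists>z\<in>C. \<forall>c\<in>C. c \<preceq> z"
  using assms
proof (induction rule: finite_ne_induct)
  case (singleton x)
  then show ?case using le_refl by auto
next
  case (insert x F)
  then obtain z where "z \<in> F" "\<forall>c\<in>F. c \<preceq> z"
    by auto
  with insert.prems show ?case
    using le_refl le_trans by (metis insertCI insertE insert_subset)
qed

text \<open>Greatest elements are peeled off one at a time, which produces the \<open>j\<close>
  deepest vertices of the chain. This segment is the target that random samples have to hit:
  everything at or below a hit stays inside it.\<close>

lemma chain_upper_segment:
  assumes "finite C" "C \<subseteq> pverts G" "\<And>a b. a \<in> C \<Longrightarrow> b \<in> C \<Longrightarrow> a \<preceq> b \<or> b \<preceq> a"
    and "j \<le> card C"
  shows "\<exists>T\<subseteq>C. card T = j \<and> (\<forall>r\<in>T. \<forall>c\<in>C. r \<preceq> c \<longrightarrow> c \<in> T)"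
  using assms(4)
proof (induction j)
  case 0
  show ?case by (rule exI[of _ "{}"]) auto
next
  case (Suc j)
  then obtain T where T: "T \<subseteq> C" "card T = j" "\<forall>r\<in>T. \<forall>c\<in>C. r \<preceq> c \<longrightarrow> c \<in> T"
    by auto
  have "C - T \<noteq> {}"
    using Suc.prems T(1,2) assms(1) by (metis Diff_eq_empty_iff not_less_eq_eq order.refl subset_antisym)
  then obtain z where z: "z \<in> C - T" "\<forall>c\<in>C - T. c \<preceq> z"
    using chain_greatest[of "C - T"] assms(1-3) by blast
  have "card (insert z T) = Suc j"
    using z T assms(1) finite_subset by (metis DiffD2 card_insert_disjoint)
  moreover have "\<forall>r\<in>insert z T. \<forall>c\<in>C. r \<preceq> c \<longrightarrow> c \<in> insert z T"
    using z T le_antisym by blast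
  ultimately show ?case
    using z T by (intro exI[of _ "insert z T"]) auto
qed

text \<open>A connected piece of a tree: it has a top vertex \<open>t\<close> and is convex, but
  need not be closed downwards, since earlier cuts may have removed lower parts. Through
  \<open>ancestors_chain\<close>, the vertex \<open>t\<close> makes the ancestors in
  \<open>S\<close> of any vertex a chain.\<close>

definition subtree :: "'a set \<Rightarrow> bool" where
  "subtree S \<longleftrightarrow> S \<subseteq> pverts G \<and> (\<exists>t\<in>S. \<forall>u\<in>S. t \<preceq> u) \<and>
     (\<forall>u\<in>S. \<forall>v\<in>S. \<forall>w. u \<preceq> w \<longrightarrow> w \<preceq> v \<longrightarrow> w \<in> S)"

definition below :: "'a set \<Rightarrow> 'a \<Rightarrow> 'a set" where
  "below S z = {u \<in> S. z \<preceq> u}"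

definition boundary :: "'a set \<Rightarrow> 'a set" where
  "boundary S = {h. h \<notin> S \<and> (\<exists>s\<in>S. (s, h) \<in> parcs G)}"

definition valid_part :: "'a set \<times> 'a set \<Rightarrow> bool" where
  "valid_part P \<longleftrightarrow> subtree (fst P) \<and> snd P = boundary (fst P)"

lemma subtree_finite: "subtree S \<Longrightarrow> finite S"
  unfolding subtree_def by (meson finite_subset pair_finite_verts)

lemma subtree_verts: "subtree S \<Longrightarrow> S \<subseteq> pverts G"
  by (simp add: subtree_def)

lemma subtree_chain:
  assumes "subtree S" "a \<in> S" "b \<in> S" "a \<preceq> x" "b \<preceq> x"
  shows "a \<preceq> b \<or> b \<preceq> a"
proof -
  obtain t where "\<forall>u\<in>S. t \<preceq> u"
    using assms(1) unfolding subtree_def by blast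
  with assms show ?thesis
    using ancestors_chain[of t a b x] by simp
qed

lemma subtree_verts_below: "r \<in> pverts G \<Longrightarrow> subtree {u. r \<preceq> u}"
  unfolding subtree_def by (auto dest: le_verts intro: le_refl le_trans)

lemma boundary_verts_below: "boundary {u. r \<preceq> u} = {}"
  unfolding boundary_def by (auto dest: arc_le le_trans)

section \<open>Effect of a cut on a part and its boundary\<close>

lemma subtree_below:
  assumes "subtree S" "z \<in> S"
  shows "subtree (below S z)"
proof -
  have "z \<in> below S z"
    using assms le_refl unfolding subtree_def below_def by blast
  moreover have "\<forall>u\<in>below S z. \<forall>v\<in>below S z. \<forall>w. u \<preceq> w \<longrightarrow> w \<preceq> v \<longrightarrow> w \<in> below S z"
    using assms(1) le_trans unfolding subtree_def below_def by blast
  ultimately show ?thesis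
    using assms(1) unfolding subtree_def below_def by blast
qed

lemma subtree_above:
  assumes "subtree S" "z \<in> S" "below S z \<noteq> S"
  shows "subtree (S - below S z)"
proof -
  obtain t where t: "t \<in> S" "\<forall>u\<in>S. t \<preceq> u"
    using assms unfolding subtree_def by blast
  have "t \<notin> below S z"
    using t assms le_trans unfolding below_def by blast
  with t have "\<exists>t\<in>S - below S z. \<forall>u\<in>S - below S z. t \<preceq> u"
    by blast
  moreover have "\<forall>u\<in>S - below S z. \<forall>v\<in>S - below S z. \<forall>w. u \<preceq> w \<longrightarrow> w \<preceq> v \<longrightarrow> w \<in> S - below S z"
    using assms(1) le_trans unfolding subtree_def below_def by blast
  ultimately show ?thesis
    using assms(1) unfolding subtree_def by blast
qed

text \<open>The last arc of a path from \<open>z\<close> to \<open>h\<close> starts at a parent of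
  \<open>h\<close> reachable from \<open>t\<close>, and \<open>s\<close> is the only such parent.
  The vertex \<open>h\<close> may lie outside \<open>S\<close>, which is what boundaries
  require.\<close>

lemma below_parent:
  assumes "subtree S" "z \<in> S" "s \<in> S" "(s, h) \<in> parcs G" "z \<preceq> h" "z \<noteq> h"
  shows "z \<preceq> s"
proof -
  obtain t where t: "t \<in> S" "\<forall>u\<in>S. t \<preceq> u"
    using assms unfolding subtree_def by blast
  obtain p where "z \<preceq> p" "(p, h) \<in> parcs G"
    using le_last assms by blast
  moreover have "p = s"
    using parent_unique[of t p s h] t assms calculation le_trans by blast
  ultimately show ?thesis by simp
qed

text \<open>The new boundary is filtered out of the old one by queries starting in \<open>z\<close>
  alone. This is why a part carries its boundary along from cut to cut.\<close>

lemma boundary_below: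
  assumes "subtree S" "z \<in> S"
  shows "boundary (below S z) = {h \<in> boundary S. z \<preceq> h}"
proof (intro set_eqI iffI)
  fix h assume "h \<in> boundary (below S z)"
  then obtain s where "s \<in> S" "z \<preceq> s" "(s, h) \<in> parcs G" "h \<notin> below S z"
    unfolding boundary_def below_def by blast
  then show "h \<in> {h \<in> boundary S. z \<preceq> h}"
    unfolding boundary_def below_def using arc_le le_trans by blast
next
  fix h assume h: "h \<in> {h \<in> boundary S. z \<preceq> h}"
  then obtain s where s: "s \<in> S" "(s, h) \<in> parcs G" "h \<notin> S"
    unfolding boundary_def by blast
  then have "z \<preceq> s"
    using below_parent[OF assms] h assms by blast
  with s show "h \<in> boundary (below S z)"
    unfolding boundary_def below_def by blast
qed

text \<open>The cut severs exactly one arc inside \<open>S\<close>, the one entering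
  \<open>z\<close>, so \<open>z\<close> is the only new head. Its tail lies in \<open>S\<close>
  because \<open>z\<close> is not the top vertex.\<close>

lemma boundary_above:
  assumes "subtree S" "z \<in> S" "below S z \<noteq> S"
  shows "boundary (S - below S z) = insert z {h \<in> boundary S. \<not> z \<preceq> h}"
proof (intro set_eqI iffI)
  fix h assume "h \<in> boundary (S - below S z)"
  then obtain s where s: "s \<in> S" "\<not> z \<preceq> s" "(s, h) \<in> parcs G" "h \<notin> S - below S z"
    unfolding boundary_def below_def by blast
  then show "h \<in> insert z {h \<in> boundary S. \<not> z \<preceq> h}"
    using below_parent[OF assms(1,2) s(1,3)] unfolding boundary_def below_def by blast
next
  fix h assume h: "h \<in> insert z {h \<in> boundary S. \<not> z \<preceq> h}"
  show "h \<in> boundary (S - below S z)"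
  proof (cases "h = z")
    case True
    obtain t where t: "t \<in> S" "\<forall>u\<in>S. t \<preceq> u"
      using assms unfolding subtree_def by blast
    have "t \<noteq> z"
      using t assms unfolding below_def by blast
    then obtain p where p: "t \<preceq> p" "(p, z) \<in> parcs G"
      using t assms le_last by blast
    have "p \<in> S"
      using p t assms arc_le unfolding subtree_def by blast
    moreover have "\<not> z \<preceq> p"
      using p arc_le arc_neq le_antisym by blast
    moreover have "z \<preceq> z"
      using assms le_refl unfolding subtree_def by blast
    ultimately show ?thesis
      using p True assms unfolding boundary_def below_def by blast
  next
    case False
    with h obtain s where "s \<in> S" "(s, h) \<in> parcs G" "h \<notin> S" "\<not> z \<preceq> h"
      unfolding boundary_def by blast
    then show ?thesis
      unfolding boundary_def below_def using arc_le le_trans by blast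
  qed
qed

section \<open>Balanced lowest common ancestors\<close>

lemma below_mono: "z \<preceq> z' \<Longrightarrow> below S z' \<subseteq> below S z"
  unfolding below_def by (auto dest: le_trans)

text \<open>Let \<open>w\<close> be a lightest vertex whose subtree holds more than half of
  \<open>S\<close>. Each child then holds at most half. If every child held less than the fraction
  \<open>1 / (4 * d)\<close>, the at most \<open>d\<close> children together would hold less than a
  quarter, too little for \<open>w\<close> to exceed one half when \<open>card S\<close> is at least
  2. So some child is a witness.\<close>

lemma heavy_vertex:
  assumes S: "subtree S" and two: "2 \<le> card S"
    and deg: "\<And>v. card {h. (v, h) \<in> parcs G} \<le> d"
  shows "\<exists>w\<in>S. card S \<le> 4 * d * card (below S w) \<and> 2 * card (below S w) \<le> card S"
proof (rule ccontr)
  assume no: "\<not> ?thesis"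
  define m where "m = card S"
  define f where "f v = card (below S v)" for v
  have fin: "finite (below S v)" for v
    using subtree_finite[OF S] by (simp add: below_def)
  obtain t where t: "t \<in> S" "\<forall>u\<in>S. t \<preceq> u"
    using S unfolding subtree_def by blast
  then have "below S t = S"
    unfolding below_def by blast
  then have "t \<in> S \<and> m < 2 * f t"
    using two by (simp add: f_def m_def t)
  then obtain w where w: "w \<in> S" "m < 2 * f w" and min: "\<And>c. c \<in> S \<Longrightarrow> m < 2 * f c \<Longrightarrow> f w \<le> f c"
    using ex_has_least_nat[of "\<lambda>v. v \<in> S \<and> m < 2 * f v" t f] by blast
  define Ch where "Ch = {c \<in> S. (w, c) \<in> parcs G}"
  have finCh: "finite Ch"
    using subtree_finite[OF S] by (simp add: Ch_def)
  have "card Ch \<le> card {h. (w, h) \<in> parcs G}"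
  proof (rule card_mono)
    show "finite {h. (w, h) \<in> parcs G}"
      by (rule finite_subset[OF _ pair_finite_verts]) (auto dest: in_arcsD2)
  qed (auto simp: Ch_def)
  then have cardCh: "card Ch \<le> d"
    using deg[of w] by simp
  have sub: "below S w \<subseteq> insert w (\<Union>c\<in>Ch. below S c)"
  proof
    fix u assume "u \<in> below S w"
    then have u: "u \<in> S" "w \<preceq> u"
      by (auto simp: below_def)
    show "u \<in> insert w (\<Union>c\<in>Ch. below S c)"
    proof (cases "u = w")
      case False
      then obtain c where c: "(w, c) \<in> parcs G" "c \<preceq> u"
        using le_first u by metis
      then have "w \<preceq> c"
        using arc_le by blast
      then have "c \<in> S"
        using S u w c unfolding subtree_def by blast
      with c u show ?thesis
        by (auto simp: Ch_def below_def)
    qed simp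
  qed
  have light: "4 * d * f c \<le> m - 1" if "c \<in> Ch" for c
  proof -
    have c: "c \<in> S" "(w, c) \<in> parcs G" "w \<preceq> c"
      using that arc_le by (auto simp: Ch_def)
    have "w \<notin> below S c"
      using c arc_neq[of w c] le_antisym[of w c] by (auto simp: below_def)
    moreover have "w \<in> below S w"
      using w(1) S le_refl[of w] unfolding below_def subtree_def by blast
    ultimately have "f c < f w"
      unfolding f_def using below_mono[OF c(3), of S] fin by (metis psubsetI psubset_card_mono)
    then have "2 * f c \<le> m"
      using min[of c] c by linarith
    then have "\<not> m \<le> 4 * d * f c"
      using no c by (auto simp: m_def f_def)
    then show ?thesis by simp
  qed
  have "f w \<le> card (insert w (\<Union>c\<in>Ch. below S c))"
    unfolding f_def using sub fin finCh by (intro card_mono) auto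
  also have "\<dots> \<le> Suc (card (\<Union>c\<in>Ch. below S c))"
    by (simp add: card_insert_le_m1)
  also have "card (\<Union>c\<in>Ch. below S c) \<le> (\<Sum>c\<in>Ch. f c)"
    unfolding f_def by (rule card_UN_le[OF finCh])
  finally have "f w \<le> Suc (\<Sum>c\<in>Ch. f c)"
    by simp
  then have "4 * d * (f w - 1) \<le> 4 * d * (\<Sum>c\<in>Ch. f c)"
    by (intro mult_le_mono) auto
  also have "\<dots> = (\<Sum>c\<in>Ch. 4 * d * f c)"
    by (simp add: sum_distrib_left)
  also have "\<dots> \<le> card Ch * (m - 1)"
    using sum_bounded_above[of Ch "\<lambda>c. 4 * d * f c" "m - 1"] light by simp
  also have "\<dots> \<le> d * (m - 1)"
    using cardCh by simp
  finally have "d * (4 * (f w - 1)) \<le> d * (m - 1)"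
    by (simp add: algebra_simps)
  moreover have "d \<noteq> 0"
  proof
    assume "d = 0"
    then have "Ch = {}"
      using cardCh finCh by simp
    then have "f w \<le> 1"
      using card_mono[OF _ sub] by (simp add: f_def)
    with w two show False
      by (simp add: m_def)
  qed
  ultimately have "4 * (f w - 1) \<le> m - 1"
    by simp
  with w two show False
    by (simp add: m_def)
qed

definition is_lca :: "'a set \<Rightarrow> 'a \<Rightarrow> 'a \<Rightarrow> 'a \<Rightarrow> bool" where
  "is_lca S x y z \<longleftrightarrow> z \<in> S \<and> z \<preceq> x \<and> z \<preceq> y \<and> (\<forall>c\<in>S. c \<preceq> x \<longrightarrow> c \<preceq> y \<longrightarrow> c \<preceq> z)"

text \<open>The factor \<open>8 * d\<close> is twice the \<open>4 * d\<close> of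
  \<open>heavy_vertex\<close>: half of the heavy subtree is given up to partners whose common
  ancestor with the first vertex is too low.\<close>

definition balanced_pairs :: "nat \<Rightarrow> 'a set \<Rightarrow> ('a \<times> 'a) set" where
  "balanced_pairs d S = {(x, y) \<in> S \<times> S. \<exists>z. is_lca S x y z \<and>
     card S \<le> 8 * d * card (below S z) \<and> 2 * card (below S z) \<le> card S}"

lemma lca_exists:
  assumes S: "subtree S" and c: "c \<in> S" "c \<preceq> x" "c \<preceq> y"
  shows "\<exists>z. is_lca S x y z"
proof -
  define C where "C = {c \<in> S. c \<preceq> x \<and> c \<preceq> y}"
  have "\<exists>z\<in>C. \<forall>c\<in>C. c \<preceq> z"
  proof (rule chain_greatest)
    show "finite C" "C \<noteq> {}" "C \<subseteq> pverts G"
      using subtree_finite[OF S] subtree_verts[OF S] c by (auto simp: C_def)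
    show "\<And>a b. a \<in> C \<Longrightarrow> b \<in> C \<Longrightarrow> a \<preceq> b \<or> b \<preceq> a"
      using subtree_chain[OF S] unfolding C_def by blast
  qed
  then show ?thesis
    by (auto simp: C_def is_lca_def)
qed

text \<open>
  Pick a vertex whose subtree holds a constant fraction, but at most half, of \<open>S\<close>. Two vertices
  from that subtree have a balanced lowest common ancestor unless they share a small subtree;
  for a fixed first vertex the small subtrees containing it are nested.
\<close>
lemma card_balanced_pairs:
  assumes S: "subtree S" and two: "2 \<le> card S"
    and deg: "\<And>v. card {h. (v, h) \<in> parcs G} \<le> d"
  shows "(card S)\<^sup>2 \<le> 32 * d\<^sup>2 * card (balanced_pairs d S)"
proof -
  define m where "m = card S"
  define f where "f v = card (below S v)" for v
  have finS: "finite S"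
    by (rule subtree_finite[OF S])
  have fin: "finite (below S v)" for v
    using finS by (simp add: below_def)
  obtain w where w: "w \<in> S" "m \<le> 4 * d * f w" "2 * f w \<le> m"
    using heavy_vertex[OF assms] by (auto simp: m_def f_def)
  have many: "m \<le> 8 * d * card {y \<in> S. (x, y) \<in> balanced_pairs d S}" if x: "x \<in> below S w" for x
  proof -
    define B where "B = {z \<in> S. z \<preceq> x \<and> 8 * d * f z < m}"
    define bad where "bad = {y \<in> below S w. \<exists>z\<in>B. is_lca S x y z}"
    have "8 * d * card bad \<le> m"
    proof (cases "B = {}")
      case True
      then show ?thesis by (simp add: bad_def)
    next
      case False
      have "finite B"
        using finS by (simp add: B_def)
      moreover from this have "Max (f ` B) \<in> f ` B"
        using False by (intro Max_in) auto
      then obtain b where "b \<in> B" "f b = Max (f ` B)"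
        by auto
      ultimately have b: "b \<in> B" "\<forall>z\<in>B. f z \<le> f b"
        by auto
      have "below S z \<subseteq> below S b" if "z \<in> B" for z
      proof -
        have "b \<preceq> z \<or> z \<preceq> b"
          using subtree_chain[OF S, of b z x] that b(1) by (simp add: B_def)
        then consider "b \<preceq> z" | "z \<preceq> b"
          by blast
        then show ?thesis
        proof cases
          case 1
          then show ?thesis by (rule below_mono)
        next
          case 2
          then have "below S b = below S z"
            using b that fin by (intro card_seteq below_mono) (auto simp: f_def)
          then show ?thesis by simp
        qed
      qed
      moreover have "y \<in> below S z" if "y \<in> below S w" "is_lca S x y z" for y z
        using that by (auto simp: below_def is_lca_def)
      ultimately have "bad \<subseteq> below S b"
        unfolding bad_def by blast
      then have "card bad \<le> f b"
        unfolding f_def by (rule card_mono[OF fin])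
      then have "8 * d * card bad \<le> 8 * d * f b"
        by (rule mult_le_mono2)
      also have "\<dots> \<le> m"
        using b(1) by (simp add: B_def)
      finally show ?thesis .
    qed
    moreover have "below S w - bad \<subseteq> {y \<in> S. (x, y) \<in> balanced_pairs d S}"
    proof
      fix y assume y: "y \<in> below S w - bad"
      then obtain z where z: "is_lca S x y z"
        using lca_exists[OF S w(1), of x y] x by (auto simp: below_def)
      have "w \<preceq> z"
        using z x y w by (auto simp: below_def is_lca_def)
      then have "f z \<le> f w"
        unfolding f_def using fin by (intro card_mono below_mono)
      then have "2 * f z \<le> m"
        using w by simp
      moreover have "z \<notin> B"
        using y z by (auto simp: bad_def)
      then have "m \<le> 8 * d * f z"
        using z by (auto simp: B_def is_lca_def)
      ultimately show "y \<in> {y \<in> S. (x, y) \<in> balanced_pairs d S}"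
        using z x y by (auto simp: balanced_pairs_def below_def m_def f_def)
    qed
    then have "card (below S w - bad) \<le> card {y \<in> S. (x, y) \<in> balanced_pairs d S}"
      using finS by (intro card_mono) auto
    then have "f w - card bad \<le> card {y \<in> S. (x, y) \<in> balanced_pairs d S}"
      unfolding f_def using card_Diff_subset[of bad "below S w"] fin[of w]
      by (auto simp: bad_def)
    then have "8 * d * (f w - card bad) \<le> 8 * d * card {y \<in> S. (x, y) \<in> balanced_pairs d S}"
      by simp
    \<comment> \<open>Doubling \<open>m <= 4 * d * f w\<close> gives at least \<open>2 * m\<close>,
      of which the bad partners take away at most \<open>m\<close>.\<close>
    moreover have "8 * d * (f w - card bad) = 2 * (4 * d * f w) - 8 * d * card bad"
      by (simp add: algebra_simps diff_mult_distrib2)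
    ultimately show ?thesis
      using w(2) by linarith
  qed
  have "m * f w \<le> (\<Sum>x\<in>below S w. 8 * d * card {y \<in> S. (x, y) \<in> balanced_pairs d S})"
    using sum_bounded_below[of "below S w" m] many by (simp add: f_def mult.commute)
  also have "\<dots> = 8 * d * card (SIGMA x:below S w. {y \<in> S. (x, y) \<in> balanced_pairs d S})"
    using fin finS by (simp add: sum_distrib_left card_SigmaI)
  also have "\<dots> \<le> 8 * d * card (balanced_pairs d S)"
    using finS by (intro mult_le_mono2 card_mono finite_subset[of "balanced_pairs d S" "S \<times> S"])
      (auto simp: balanced_pairs_def)
  finally have *: "m * f w \<le> 8 * d * card (balanced_pairs d S)" .
  have "m * m \<le> m * (4 * d * f w)"
    using w(2) by simp
  also have "\<dots> = 4 * d * (m * f w)"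
    by simp
  also have "\<dots> \<le> 4 * d * (8 * d * card (balanced_pairs d S))"
    using * by (intro mult_le_mono2)
  finally show ?thesis
    by (simp add: m_def power2_eq_square algebra_simps)
qed

end

section \<open>Sampling and query costs\<close>

lemma measure_bind_pmf_eq:
  "measure_pmf.prob (bind_pmf M N) X = measure_pmf.expectation M (\<lambda>x. measure_pmf.prob (N x) X)"
proof -
  have "integrable (measure_pmf M) (\<lambda>x. measure_pmf.prob (N x) X)"
    by (rule measure_pmf.integrable_const_bound[where B = 1]) auto
  then have "(\<integral>\<^sup>+x. emeasure (N x) X \<partial>M) = ennreal (measure_pmf.expectation M (\<lambda>x. measure_pmf.prob (N x) X))"
    by (simp add: measure_pmf.emeasure_eq_measure nn_integral_eq_integral)
  then show ?thesis
    by (simp add: measure_def integral_nonneg)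
qed

lemma prob_replicate_pmf_subset:
  "measure_pmf.prob (replicate_pmf n p) {xs. set xs \<subseteq> B} = measure_pmf.prob p B ^ n"
proof (induction n)
  case 0
  show ?case by simp
next
  case (Suc n)
  have "replicate_pmf (Suc n) p = bind_pmf p (\<lambda>x. map_pmf ((#) x) (replicate_pmf n p))"
    by (simp add: map_pmf_def)
  then have "measure_pmf.prob (replicate_pmf (Suc n) p) {xs. set xs \<subseteq> B} =
      measure_pmf.expectation p (\<lambda>x. measure_pmf.prob (replicate_pmf n p) {xs. x \<in> B \<and> set xs \<subseteq> B})"
    by (simp add: measure_bind_pmf_eq vimage_def)
  also have "\<dots> = measure_pmf.expectation p (\<lambda>x. indicator B x * measure_pmf.prob p B ^ n)"
    using Suc by (intro Bochner_Integration.integral_cong) (auto simp: indicator_def)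
  finally show ?case
    by simp
qed

primrec label_pmf :: "('p \<Rightarrow> 'w pmf) \<Rightarrow> 'p list \<Rightarrow> ('p \<times> 'w) list pmf" where
  "label_pmf D [] = return_pmf []"
| "label_pmf D (p # ps) =
     map_pmf (\<lambda>x. (p, fst x) # snd x) (pair_pmf (D p) (label_pmf D ps))"

lemma set_label_pmf:
  assumes "L \<in> set_pmf (label_pmf D ps)"
  shows "map fst L = ps" "\<And>p w. (p, w) \<in> set L \<Longrightarrow> w \<in> set_pmf (D p)"
proof -
  have "map fst L = ps \<and> (\<forall>(p, w)\<in>set L. w \<in> set_pmf (D p))"
    using assms by (induction ps arbitrary: L) fastforce+
  then show "map fst L = ps" "\<And>p w. (p, w) \<in> set L \<Longrightarrow> w \<in> set_pmf (D p)"
    by auto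
qed

lemma finite_label_pmf:
  "(\<And>p. p \<in> set ps \<Longrightarrow> finite (set_pmf (D p))) \<Longrightarrow> finite (set_pmf (label_pmf D ps))"
  by (induction ps) auto

text \<open>Linearity of expectation over the simultaneous picks; finite supports supply
  integrability.\<close>

lemma expectation_label_pmf:
  fixes f :: "'p \<times> 'w \<Rightarrow> real"
  assumes "\<And>p. p \<in> set ps \<Longrightarrow> finite (set_pmf (D p))"
  shows "measure_pmf.expectation (label_pmf D ps) (\<lambda>L. \<Sum>x\<leftarrow>L. f x) =
     (\<Sum>p\<leftarrow>ps. measure_pmf.expectation (D p) (\<lambda>w. f (p, w)))"
  using assms
proof (induction ps)
  case Nil
  show ?case by simp
next
  case (Cons p ps)
  have fin: "finite (set_pmf (pair_pmf (D p) (label_pmf D ps)))"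
    using finite_label_pmf[of ps D] Cons.prems by simp
  have "measure_pmf.expectation (label_pmf D (p # ps)) (\<lambda>L. \<Sum>x\<leftarrow>L. f x) =
      measure_pmf.expectation (pair_pmf (D p) (label_pmf D ps))
        (\<lambda>x. f (p, fst x) + (\<Sum>y\<leftarrow>snd x. f y))"
    by simp
  also have "\<dots> = measure_pmf.expectation (pair_pmf (D p) (label_pmf D ps)) (\<lambda>x. f (p, fst x)) +
      measure_pmf.expectation (pair_pmf (D p) (label_pmf D ps)) (\<lambda>x. \<Sum>y\<leftarrow>snd x. f y)"
    by (intro Bochner_Integration.integral_add integrable_measure_pmf_finite fin)
  also have "\<dots> = measure_pmf.expectation (D p) (\<lambda>w. f (p, w)) +
      measure_pmf.expectation (label_pmf D ps) (\<lambda>L. \<Sum>y\<leftarrow>L. f y)"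
    using expectation_pair_pmf_fst[of "D p" "label_pmf D ps" "\<lambda>w. f (p, w)"]
      expectation_pair_pmf_snd[of "D p" "label_pmf D ps" "\<lambda>L. \<Sum>y\<leftarrow>L. f y"]
    by simp
  finally show ?case
    using Cons by simp
qed

section \<open>Batches as sets, and failure within a budget\<close>

definition enum :: "'b set \<Rightarrow> 'b list" where
  "enum Q = (SOME xs. set xs = Q \<and> distinct xs)"

lemma enum:
  assumes "finite Q"
  shows "set (enum Q) = Q" "length (enum Q) = card Q"
proof -
  have "set (enum Q) = Q \<and> distinct (enum Q)"
    unfolding enum_def using finite_distinct_list[OF assms] by (rule someI_ex)
  then show "set (enum Q) = Q" "length (enum Q) = card Q"
    using distinct_card[of "enum Q"] by auto
qed

text \<open>A batch is handled as a set, queried in an arbitrary enumeration without repetition, and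
  the answers are turned back into the set of positive queries. Sets make it easy to merge the
  batches of many parts and to compare partial knowledge with the full relation.\<close>

definition ask :: "('a \<times> 'a) set \<Rightarrow> (('a \<times> 'a) set \<Rightarrow> 'a query_alg) \<Rightarrow> 'a query_alg" where
  "ask Q k = Round (enum Q) (\<lambda>bs. k {q. map_of (zip (enum Q) bs) q = Some True})"

text \<open>A wrong output and the overrun of either budget form one event, so a single recursive
  estimate controls correctness, queries and rounds together.\<close>

definition fail :: "('a \<times> 'a \<Rightarrow> bool) \<Rightarrow> ('a \<times> 'a) set \<Rightarrow> nat \<Rightarrow> nat \<Rightarrow> 'a query_alg \<Rightarrow> real" where
  "fail ans E q r alg =
     measure_pmf.prob (run ans alg) {(A, q', r'). \<not> (A = E \<and> q' \<le> q \<and> r' \<le> r)}"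

lemma fail_le_1: "fail ans E q r alg \<le> 1"
  by (simp add: fail_def)

lemma fail_Output [simp]: "fail ans E q r (Output E) = 0"
  by (simp add: fail_def)

lemma fail_mono: "q \<le> q' \<Longrightarrow> r \<le> r' \<Longrightarrow> fail ans E q' r' alg \<le> fail ans E q r alg"
  unfolding fail_def by (intro measure_pmf.finite_measure_mono) auto

lemma fail_Sample:
  "fail ans E q r (Sample (map_pmf f P)) = measure_pmf.expectation P (\<lambda>x. fail ans E q r (f x))"
proof -
  have "run ans (Sample (map_pmf f P)) = bind_pmf P (\<lambda>x. run ans (f x))"
    by (simp add: join_eq_bind_pmf bind_map_pmf map_pmf_comp o_def)
  then show ?thesis
    by (simp add: fail_def measure_bind_pmf_eq)
qed

lemma fail_Sample_le:
  assumes "finite (set_pmf P)" "\<And>x. x \<in> set_pmf P \<Longrightarrow> fail ans E q r (f x) \<le> g x"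
  shows "fail ans E q r (Sample (map_pmf f P)) \<le> measure_pmf.expectation P g"
  unfolding fail_Sample using assms
  by (intro integral_mono_AE integrable_measure_pmf_finite) (auto simp: AE_measure_pmf_iff)

lemma map_of_zip_map_answers:
  "map_of (zip xs (map f xs)) q = (if q \<in> set xs then Some (f q) else None)"
  by (simp add: map_of_zip_map)

text \<open>The answers to a fixed batch are deterministic, so asking it only consumes budget. The
  slack \<open>card Q <= b\<close> allows uniform bounds for adaptively formed batches.\<close>

lemma fail_ask:
  assumes "finite Q" "card Q \<le> b"
  shows "fail ans E (b + q) (Suc r) (ask Q k) \<le> fail ans E q r (k {x \<in> Q. ans x})"
proof -
  have *: "{x. map_of (zip (enum Q) (map ans (enum Q))) x = Some True} = {x \<in> Q. ans x}"
    using enum[OF assms(1)] by (auto simp: map_of_zip_map_answers split: if_splits)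
  show ?thesis
    using assms enum[OF assms(1)] unfolding fail_def ask_def run.simps * measure_map_pmf
    by (intro measure_pmf.finite_measure_mono) auto
qed

section \<open>One level of parallel splitting\<close>

definition bottom :: "('a \<times> 'a) set \<Rightarrow> 'a set \<Rightarrow> 'a" where
  "bottom A C = (SOME z. z \<in> C \<and> (\<forall>c\<in>C. (c, z) \<in> A))"

lemma bottom_cong: "A \<inter> C \<times> C = B \<inter> C \<times> C \<Longrightarrow> bottom A C = bottom B C"
  unfolding bottom_def by (rule arg_cong[where f = Eps]) blast

text \<open>
  A part \<open>(S, H)\<close> consists of a subtree \<open>S\<close> and the heads \<open>H\<close> of the arcs leaving \<open>S\<close>, so the
  arcs can be read off once every \<open>S\<close> is a singleton. A pick \<open>((x, y), R)\<close> holds the two vertices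
  whose lowest common ancestor is sought and the random sample used for finding it.
\<close>

type_synonym 'a part = "'a set \<times> 'a set"
type_synonym 'a pick = "('a \<times> 'a) \<times> 'a list"

text \<open>With \<open>k\<close> samples and \<open>m = card S\<close>, comparing the samples costs
  \<open>k^2\<close> queries, while all of them miss a fixed set of \<open>k\<close> vertices with
  probability at most \<open>exp (- (k^2 / m))\<close>. Both are satisfactory when
  \<open>k^2\<close> has the order of \<open>m\<close>.\<close>

definition sample_size :: "'a set \<Rightarrow> nat" where
  "sample_size S = nat \<lceil>sqrt (real (card S))\<rceil>"

definition pick_pmf :: "'a part \<Rightarrow> 'a pick pmf" where
  "pick_pmf P = pair_pmf (pmf_of_set (fst P \<times> fst P)) (replicate_pmf (sample_size (fst P)) (pmf_of_set (fst P)))"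

text \<open>
  In these functions \<open>A\<close> is the set of queries known to have a positive answer. Each function
  depends only on the answers to the batches preceding it, which is what the congruence lemmas say.
\<close>

fun common :: "('a \<times> 'a) set \<Rightarrow> 'a part \<times> 'a pick \<Rightarrow> 'a set" where
  "common A ((S, H), ((x, y), R)) = {c \<in> S. (c, x) \<in> A \<and> (c, y) \<in> A}"

fun samples :: "('a \<times> 'a) set \<Rightarrow> 'a part \<times> 'a pick \<Rightarrow> 'a set" where
  "samples A (P, (xy, R)) = set R \<inter> common A (P, (xy, R))"

fun low :: "('a \<times> 'a) set \<Rightarrow> 'a part \<times> 'a pick \<Rightarrow> 'a set" where
  "low A w = (if samples A w = {} then common A w
     else {c \<in> common A w. (bottom A (samples A w), c) \<in> A})"

text \<open>If the remaining segment is too long to be compared pairwise, \<open>x\<close> is a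
  harmless fallback: cutting there is still correct and only the guarantee of balance is
  lost.\<close>

fun pivot :: "('a \<times> 'a) set \<Rightarrow> 'a part \<times> 'a pick \<Rightarrow> 'a" where
  "pivot A ((S, H), ((x, y), R)) =
     (if card (low A ((S, H), ((x, y), R))) \<le> sample_size S
      then bottom A (low A ((S, H), ((x, y), R))) else x)"

text \<open>The guard keeps both pieces nonempty; otherwise the part survives unchanged.\<close>

definition split_part :: "('a \<times> 'a) set \<Rightarrow> 'a part \<Rightarrow> 'a \<Rightarrow> 'a part list" where
  "split_part A P z = (let D = {u \<in> fst P. (z, u) \<in> A} in
     if z \<in> fst P \<and> D \<noteq> fst P
     then [(D, {h \<in> snd P. (z, h) \<in> A}), (fst P - D, insert z {h \<in> snd P. (z, h) \<notin> A})]
     else [P])"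

text \<open>The samples are compared with each other before it is known which of them lie on the
  chain, so that both kinds of query fit into one round.\<close>

fun queries1 :: "'a part \<times> 'a pick \<Rightarrow> ('a \<times> 'a) set" where
  "queries1 ((S, H), ((x, y), R)) = S \<times> {x, y} \<union> set R \<times> set R"

text \<open>If no sample lies on the chain, the first component is an arbitrary vertex, and
  \<open>low\<close> ignores the comparison with it.\<close>

fun queries2 :: "('a \<times> 'a) set \<Rightarrow> 'a part \<times> 'a pick \<Rightarrow> ('a \<times> 'a) set" where
  "queries2 A w = {bottom A (samples A w)} \<times> common A w"

fun queries3 :: "('a \<times> 'a) set \<Rightarrow> 'a part \<times> 'a pick \<Rightarrow> ('a \<times> 'a) set" where
  "queries3 A (P, s) =
     (if card (low A (P, s)) \<le> sample_size (fst P) then low A (P, s) \<times> low A (P, s) else {})"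

fun queries4 :: "('a \<times> 'a) set \<Rightarrow> 'a part \<times> 'a pick \<Rightarrow> ('a \<times> 'a) set" where
  "queries4 A (P, s) = {pivot A (P, s)} \<times> (fst P \<union> snd P)"

lemma common_cong:
  assumes "A \<inter> queries1 w = B \<inter> queries1 w"
  shows "common A w = common B w"
proof (cases "(A, w)" rule: common.cases)
  case (1 A' S H x y R)
  then have *: "q \<in> A \<longleftrightarrow> q \<in> B" if "q \<in> S \<times> {x, y}" for q
    using assms that by (simp add: set_eq_iff) blast
  show ?thesis
    using 1 * by auto
qed

lemma samples_cong:
  assumes "A \<inter> queries1 w = B \<inter> queries1 w"
  shows "samples A w = samples B w"
  using common_cong[OF assms] by (cases "(A, w)" rule: samples.cases) simp

lemma bottom_samples_cong:
  assumes "A \<inter> queries1 w = B \<inter> queries1 w"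
  shows "bottom A (samples A w) = bottom B (samples B w)"
proof -
  have "samples A w \<times> samples A w \<subseteq> queries1 w"
    by (cases "(A, w)" rule: common.cases) auto
  then have "bottom A (samples A w) = bottom B (samples A w)"
    using assms by (intro bottom_cong) blast
  then show ?thesis
    by (simp add: samples_cong[OF assms])
qed

lemma queries2_cong:
  assumes "A \<inter> queries1 w = B \<inter> queries1 w"
  shows "queries2 A w = queries2 B w"
  using common_cong[OF assms] bottom_samples_cong[OF assms] by simp

lemma low_cong:
  assumes "A \<inter> queries1 w = B \<inter> queries1 w" "A \<inter> queries2 B w = B \<inter> queries2 B w"
  shows "low A w = low B w"
proof -
  have "c \<in> common B w \<Longrightarrow> (bottom B (samples B w), c) \<in> A \<longleftrightarrow> (bottom B (samples B w), c) \<in> B" for c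
    using assms(2) by (simp add: set_eq_iff) blast
  then show ?thesis
    using common_cong[OF assms(1)] samples_cong[OF assms(1)] bottom_samples_cong[OF assms(1)]
    by auto
qed

lemma queries3_cong:
  assumes "A \<inter> queries1 w = B \<inter> queries1 w" "A \<inter> queries2 B w = B \<inter> queries2 B w"
  shows "queries3 A w = queries3 B w"
  using low_cong[OF assms] by (cases w) (simp del: low.simps)

lemma pivot_cong:
  assumes "A \<inter> queries1 w = B \<inter> queries1 w" "A \<inter> queries2 B w = B \<inter> queries2 B w"
    "A \<inter> queries3 B w = B \<inter> queries3 B w"
  shows "pivot A w = pivot B w"
proof (cases "(A, w)" rule: pivot.cases)
  case (1 A' S H x y R)
  show ?thesis
  proof (cases "card (low B w) \<le> sample_size S")
    case True
    then have "bottom A (low B w) = bottom B (low B w)"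
      using assms(3) 1 by (intro bottom_cong) (simp del: low.simps)
    then show ?thesis
      using low_cong[OF assms(1,2)] 1 by (simp del: low.simps)
  next
    case False
    then show ?thesis
      using low_cong[OF assms(1,2)] 1 by (simp del: low.simps)
  qed
qed

lemma split_part_cong:
  assumes "A \<inter> {z} \<times> (fst P \<union> snd P) = B \<inter> {z} \<times> (fst P \<union> snd P)"
  shows "split_part A P z = split_part B P z"
proof -
  have "(z, u) \<in> A \<longleftrightarrow> (z, u) \<in> B" if "u \<in> fst P \<union> snd P" for u
    using assms that by blast
  then have "{u \<in> fst P. (z, u) \<in> A} = {u \<in> fst P. (z, u) \<in> B}"
    "{h \<in> snd P. (z, h) \<in> A} = {h \<in> snd P. (z, h) \<in> B}"
    "{h \<in> snd P. (z, h) \<notin> A} = {h \<in> snd P. (z, h) \<notin> B}"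
    by auto
  then show ?thesis
    unfolding split_part_def by (simp only:)
qed

definition refine :: "('a \<times> 'a) set \<Rightarrow> ('a part \<times> 'a pick) list \<Rightarrow> 'a part list" where
  "refine A L = concat (map (\<lambda>w. split_part A (fst w) (pivot A w)) L)"

text \<open>Every batch is shared by all parts, so a level takes four rounds however many parts
  there are.\<close>

definition level :: "'a part list \<Rightarrow> ('a part list \<Rightarrow> 'a query_alg) \<Rightarrow> 'a query_alg" where
  "level Ps k = Sample (map_pmf (\<lambda>L.
     ask (\<Union>w\<in>set L. queries1 w) (\<lambda>A1.
     ask (\<Union>w\<in>set L. queries2 A1 w) (\<lambda>A2.
     ask (\<Union>w\<in>set L. queries3 (A1 \<union> A2) w) (\<lambda>A3.
     ask (\<Union>w\<in>set L. queries4 (A1 \<union> A2 \<union> A3) w) (\<lambda>A4.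
     k (refine (A1 \<union> A2 \<union> A3 \<union> A4) L)))))) (label_pmf pick_pmf Ps))"

section \<open>Query cost of one level\<close>

lemma card_UN_list_le: "card (\<Union>x\<in>set xs. f x) \<le> (\<Sum>x\<leftarrow>xs. card (f x))"
proof (induction xs)
  case (Cons x xs)
  then show ?case
    using card_Un_le[of "f x" "\<Union>x\<in>set xs. f x"] by simp
qed simp

lemma sample_size_sq_le: "(sample_size S)\<^sup>2 \<le> 4 * card S"
proof (cases "card S = 0")
  case True
  then show ?thesis by (simp add: sample_size_def)
next
  case False
  then have "1 \<le> sqrt (real (card S))"
    by simp
  moreover have "real (sample_size S) \<le> sqrt (real (card S)) + 1"
    using of_int_ceiling_le_add_one[of "sqrt (real (card S))"] by (simp add: sample_size_def)
  ultimately have "real (sample_size S) \<le> 2 * sqrt (real (card S))"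
    by linarith
  then have "(real (sample_size S))\<^sup>2 \<le> (2 * sqrt (real (card S)))\<^sup>2"
    by (rule power_mono) simp
  then have "real ((sample_size S)\<^sup>2) \<le> real (4 * card S)"
    by (simp add: power_mult_distrib)
  then show ?thesis
    by (simp only: of_nat_le_iff)
qed

lemma le_sample_size_sq: "card S \<le> (sample_size S)\<^sup>2"
proof -
  have "sqrt (real (card S)) \<le> real (sample_size S)"
    unfolding sample_size_def by (rule real_nat_ceiling_ge)
  then have "(sqrt (real (card S)))\<^sup>2 \<le> (real (sample_size S))\<^sup>2"
    by (rule power_mono) simp
  then have "real (card S) \<le> real ((sample_size S)\<^sup>2)"
    by simp
  then show ?thesis
    by (simp only: of_nat_le_iff)
qed

lemma set_pick_pmf:
  assumes "finite S" "S \<noteq> {}" "((x, y), R) \<in> set_pmf (pick_pmf (S, H))"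
  shows "x \<in> S" "y \<in> S" "set R \<subseteq> S" "length R = sample_size S"
  using assms by (auto simp: pick_pmf_def set_pmf_of_set set_replicate_pmf in_lists_conv_set)

lemma finite_pick_pmf:
  assumes "finite (fst P)" "fst P \<noteq> {}"
  shows "finite (set_pmf (pick_pmf P))"
proof -
  have "{xs \<in> lists (fst P). length xs = n} = {xs. set xs \<subseteq> fst P \<and> length xs = n}" for n
    by (auto simp: in_lists_conv_set)
  then show ?thesis
    using assms finite_lists_length_eq[of "fst P"]
    by (simp add: pick_pmf_def set_pmf_of_set set_replicate_pmf)
qed

lemma common_subset: "common A (P, s) \<subseteq> fst P"
  by (cases "(A, (P, s))" rule: common.cases) auto

lemma low_subset: "low A (P, s) \<subseteq> fst P"
  using common_subset[of A P s] by auto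

lemma card_queries:
  assumes S: "finite (fst P)" "fst P \<noteq> {}" and H: "finite (snd P)" "card (snd P) \<le> d * card (fst P)"
    and s: "s \<in> set_pmf (pick_pmf P)"
  shows "finite (queries1 (P, s))" "card (queries1 (P, s)) \<le> 6 * card (fst P)"
    and "finite (queries2 A (P, s))" "card (queries2 A (P, s)) \<le> card (fst P)"
    and "finite (queries3 A (P, s))" "card (queries3 A (P, s)) \<le> 4 * card (fst P)"
    and "finite (queries4 A (P, s))" "card (queries4 A (P, s)) \<le> Suc d * card (fst P)"
proof -
  obtain S H x y R where w: "P = (S, H)" "s = ((x, y), R)"
    by (metis surj_pair)
  have sub: "x \<in> S" "y \<in> S" "set R \<subseteq> S" "length R = sample_size S"
    using set_pick_pmf[of S x y R H] s S w by auto
  show "finite (queries1 (P, s))"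
    using S w by simp
  have "card (S \<times> {x, y}) \<le> card S * 2"
    unfolding card_cartesian_product by (intro mult_le_mono2) (simp add: card_insert_if)
  moreover have "card (set R \<times> set R) \<le> (sample_size S)\<^sup>2"
    unfolding card_cartesian_product power2_eq_square
    using card_length[of R] sub by (intro mult_le_mono) auto
  ultimately show "card (queries1 (P, s)) \<le> 6 * card (fst P)"
    using card_Un_le[of "S \<times> {x, y}" "set R \<times> set R"] sample_size_sq_le[of S] w by simp
  have fin: "finite (common A (P, s))" "finite (low A (P, s))"
    using S common_subset low_subset finite_subset by metis+
  show "finite (queries2 A (P, s))"
    using fin by simp
  show "card (queries2 A (P, s)) \<le> card (fst P)"
    using card_mono[OF S(1) common_subset[of A P s]] by (simp add: card_cartesian_product)
  show "finite (queries3 A (P, s))"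
    using fin by (simp del: low.simps)
  have "card (low A (P, s) \<times> low A (P, s)) \<le> (sample_size (fst P))\<^sup>2"
    if "card (low A (P, s)) \<le> sample_size (fst P)"
    unfolding card_cartesian_product power2_eq_square using that by (intro mult_le_mono)
  then show "card (queries3 A (P, s)) \<le> 4 * card (fst P)"
    using sample_size_sq_le[of "fst P"] by (auto simp del: low.simps intro: order_trans)
  show "finite (queries4 A (P, s))"
    using S H by simp
  show "card (queries4 A (P, s)) \<le> Suc d * card (fst P)"
    using H card_Un_le[of "fst P" "snd P"] by (simp add: card_cartesian_product)
qed

text \<open>Each batch is computed from the answers received so far, but the congruence lemmas
  identify it with the batch computed from the full relation \<open>Collect ans\<close>. From here
  on the adaptivity inside a level can be forgotten. The factor \<open>12 + d\<close> is the sum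
  \<open>6 + 1 + 4 + Suc d\<close> of the bounds in \<open>card_queries\<close>.\<close>

lemma fail_level:
  assumes parts: "\<And>P. P \<in> set Ps \<Longrightarrow> finite (fst P) \<and> fst P \<noteq> {} \<and> finite (snd P) \<and> card (snd P) \<le> d * card (fst P)"
    and N: "(\<Sum>P\<leftarrow>Ps. card (fst P)) \<le> N"
  shows "fail ans E ((12 + d) * N + q) (4 + r) (level Ps k) \<le>
    measure_pmf.expectation (label_pmf pick_pmf Ps) (\<lambda>L. fail ans E q r (k (refine (Collect ans) L)))"
  unfolding level_def
proof (rule fail_Sample_le)
  show "finite (set_pmf (label_pmf pick_pmf Ps))"
    using parts by (intro finite_label_pmf finite_pick_pmf) auto
  fix L assume L: "L \<in> set_pmf (label_pmf pick_pmf Ps)"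
  have mem: "fst w \<in> set Ps" "snd w \<in> set_pmf (pick_pmf (fst w))" if "w \<in> set L" for w
    using set_label_pmf(1)[OF L, symmetric] set_label_pmf(2)[OF L, of "fst w" "snd w"] that by simp_all
  have bound: "card (\<Union>w\<in>set L. Q w) \<le> c * N" if "\<And>w. w \<in> set L \<Longrightarrow> card (Q w) \<le> c * card (fst (fst w))"
    for Q :: "'a part \<times> 'a pick \<Rightarrow> ('a \<times> 'a) set" and c
  proof -
    have "card (\<Union>w\<in>set L. Q w) \<le> (\<Sum>w\<leftarrow>L. card (Q w))"
      by (rule card_UN_list_le)
    also have "\<dots> \<le> (\<Sum>w\<leftarrow>L. c * card (fst (fst w)))"
      using that by (intro sum_list_mono) auto
    also have "\<dots> = c * (\<Sum>P\<leftarrow>map fst L. card (fst P))"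
      by (simp add: sum_list_const_mult o_def)
    also have "\<dots> \<le> c * N"
      using set_label_pmf(1)[OF L] N by simp
    finally show ?thesis .
  qed
  define B where "B = Collect ans"
  define U1 where "U1 = (\<Union>w\<in>set L. queries1 w)"
  define U2 where "U2 = (\<Union>w\<in>set L. queries2 B w)"
  define U3 where "U3 = (\<Union>w\<in>set L. queries3 B w)"
  define U4 where "U4 = (\<Union>w\<in>set L. queries4 B w)"
  have q: "finite (queries1 w)" "card (queries1 w) \<le> 6 * card (fst (fst w))"
    "finite (queries2 B w)" "card (queries2 B w) \<le> 1 * card (fst (fst w))"
    "finite (queries3 B w)" "card (queries3 B w) \<le> 4 * card (fst (fst w))"
    "finite (queries4 B w)" "card (queries4 B w) \<le> Suc d * card (fst (fst w))" if "w \<in> set L" for w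
  proof -
    obtain P s where w: "w = (P, s)"
      by (cases w)
    have "finite (fst P)" "fst P \<noteq> {}" "finite (snd P)" "card (snd P) \<le> d * card (fst P)" "s \<in> set_pmf (pick_pmf P)"
      using mem[OF that] parts[of P] w by auto
    note c = card_queries[OF this]
    show "finite (queries1 w)" "card (queries1 w) \<le> 6 * card (fst (fst w))"
      "finite (queries2 B w)" "card (queries2 B w) \<le> 1 * card (fst (fst w))"
      "finite (queries3 B w)" "card (queries3 B w) \<le> 4 * card (fst (fst w))"
      "finite (queries4 B w)" "card (queries4 B w) \<le> Suc d * card (fst (fst w))"
      unfolding w fst_conv mult_1 by (rule c)+
  qed
  have fin: "finite U1" "finite U2" "finite U3" "finite U4"
    unfolding U1_def U2_def U3_def U4_def using q by (auto simp del: queries2.simps)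
  have card: "card U1 \<le> 6 * N" "card U2 \<le> 1 * N" "card U3 \<le> 4 * N" "card U4 \<le> Suc d * N"
    unfolding U1_def U2_def U3_def U4_def by (intro bound q; assumption)+
  define A1 where "A1 = {q \<in> U1. ans q}"
  define A2 where "A2 = {q \<in> U2. ans q}"
  define A3 where "A3 = {q \<in> U3. ans q}"
  define A4 where "A4 = {q \<in> U4. ans q}"
  have A: "A1 = B \<inter> U1" "A2 = B \<inter> U2" "A3 = B \<inter> U3" "A4 = B \<inter> U4"
    by (auto simp: A1_def A2_def A3_def A4_def B_def)
  have sub: "queries1 w \<subseteq> U1" "queries2 B w \<subseteq> U2" "queries3 B w \<subseteq> U3" "queries4 B w \<subseteq> U4"
    if "w \<in> set L" for w
    unfolding U1_def U2_def U3_def U4_def by (rule UN_upper[OF that])+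
  have U2: "(\<Union>w\<in>set L. queries2 A1 w) = U2"
    unfolding U2_def by (intro SUP_cong queries2_cong refl) (use sub A(1) in blast)
  have 3: "(A1 \<union> A2) \<inter> queries1 w = B \<inter> queries1 w" "(A1 \<union> A2) \<inter> queries2 B w = B \<inter> queries2 B w"
    if "w \<in> set L" for w
    using sub[OF that] unfolding A by blast+
  have U3: "(\<Union>w\<in>set L. queries3 (A1 \<union> A2) w) = U3"
    unfolding U3_def by (intro SUP_cong queries3_cong refl 3)
  have 4: "(A1 \<union> A2 \<union> A3) \<inter> queries1 w = B \<inter> queries1 w"
    "(A1 \<union> A2 \<union> A3) \<inter> queries2 B w = B \<inter> queries2 B w"
    "(A1 \<union> A2 \<union> A3) \<inter> queries3 B w = B \<inter> queries3 B w" if "w \<in> set L" for w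
    using sub[OF that] unfolding A by blast+
  have "queries4 (A1 \<union> A2 \<union> A3) w = queries4 B w" if "w \<in> set L" for w
    using pivot_cong[OF 4[OF that]] by (cases w) (simp del: pivot.simps)
  then have U4: "(\<Union>w\<in>set L. queries4 (A1 \<union> A2 \<union> A3) w) = U4"
    unfolding U4_def by (intro SUP_cong refl)
  have 5: "(A1 \<union> A2 \<union> A3 \<union> A4) \<inter> queries1 w = B \<inter> queries1 w"
    "(A1 \<union> A2 \<union> A3 \<union> A4) \<inter> queries2 B w = B \<inter> queries2 B w"
    "(A1 \<union> A2 \<union> A3 \<union> A4) \<inter> queries3 B w = B \<inter> queries3 B w"
    "(A1 \<union> A2 \<union> A3 \<union> A4) \<inter> queries4 B w = B \<inter> queries4 B w" if "w \<in> set L" for w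
    using sub[OF that] unfolding A by blast+
  have refine: "refine (A1 \<union> A2 \<union> A3 \<union> A4) L = refine B L"
  proof -
    have "split_part (A1 \<union> A2 \<union> A3 \<union> A4) (fst w) (pivot (A1 \<union> A2 \<union> A3 \<union> A4) w) =
        split_part B (fst w) (pivot B w)" if "w \<in> set L" for w
    proof -
      obtain P s where w: "w = (P, s)"
        by (cases w)
      show ?thesis
        unfolding pivot_cong[OF 5(1-3)[OF that]]
        by (rule split_part_cong) (use 5(4)[OF that] in \<open>simp only: w queries4.simps fst_conv\<close>)
    qed
    then show ?thesis
      unfolding refine_def by (intro arg_cong[where f = concat] map_cong refl) auto
  qed
  have *: "fail ans E (6 * N + (1 * N + (4 * N + (Suc d * N + q)))) (Suc (Suc (Suc (Suc r))))
    (ask U1 (\<lambda>A1. ask (\<Union>w\<in>set L. queries2 A1 w) (\<lambda>A2.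
       ask (\<Union>w\<in>set L. queries3 (A1 \<union> A2) w) (\<lambda>A3.
       ask (\<Union>w\<in>set L. queries4 (A1 \<union> A2 \<union> A3) w) (\<lambda>A4. k (refine (A1 \<union> A2 \<union> A3 \<union> A4) L))))))
    \<le> fail ans E q r (k (refine B L))"
    apply (rule order_trans[OF fail_ask[OF fin(1) card(1)]])
    apply (fold A1_def, unfold U2)
    apply (rule order_trans[OF fail_ask[OF fin(2) card(2)]])
    apply (fold A2_def, unfold U3)
    apply (rule order_trans[OF fail_ask[OF fin(3) card(3)]])
    apply (fold A3_def, unfold U4)
    apply (rule order_trans[OF fail_ask[OF fin(4) card(4)]])
    apply (fold A4_def, unfold refine)
    apply (rule order_refl)
    done
  have q_eq: "(12 + d) * N + q = 6 * N + (1 * N + (4 * N + (Suc d * N + q)))"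
    and r_eq: "4 + r = Suc (Suc (Suc (Suc r)))"
    by (simp_all add: algebra_simps)
  show "fail ans E ((12 + d) * N + q) (4 + r)
    (ask (\<Union>w\<in>set L. queries1 w) (\<lambda>A1. ask (\<Union>w\<in>set L. queries2 A1 w) (\<lambda>A2.
       ask (\<Union>w\<in>set L. queries3 (A1 \<union> A2) w) (\<lambda>A3.
       ask (\<Union>w\<in>set L. queries4 (A1 \<union> A2 \<union> A3) w) (\<lambda>A4. k (refine (A1 \<union> A2 \<union> A3 \<union> A4) L))))))
    \<le> fail ans E q r (k (refine (Collect ans) L))"
    unfolding U1_def[symmetric] B_def[symmetric] q_eq r_eq by (rule *)
qed

section \<open>Expected decrease of the potential in one level\<close>

context multitree
begin

abbreviation reach :: "('a \<times> 'a) set" where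
  "reach \<equiv> Collect (path_query G)"

lemma mem_reach [simp]: "path_query G (u, v) \<longleftrightarrow> u \<preceq> v"
  by (simp add: path_query_def)

text \<open>The number of ordered pairs of distinct vertices in the part. It vanishes on singletons
  and is at least 2 on larger parts.\<close>

definition pot :: "'a part \<Rightarrow> real" where
  "pot P = real (card (fst P)) * (real (card (fst P)) - 1)"

lemma split_part_reach:
  "split_part reach P z = (if z \<in> fst P \<and> below (fst P) z \<noteq> fst P
     then [(below (fst P) z, {h \<in> snd P. z \<preceq> h}), (fst P - below (fst P) z, insert z {h \<in> snd P. \<not> z \<preceq> h})]
     else [P])"
  by (simp add: split_part_def below_def Let_def)

lemma split_part_valid:
  assumes "valid_part P" "P' \<in> set (split_part reach P z)"
  shows "valid_part P'"
proof (cases "z \<in> fst P \<and> below (fst P) z \<noteq> fst P")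
  case True
  have S: "subtree (fst P)" "snd P = boundary (fst P)"
    using assms(1) by (auto simp: valid_part_def)
  from True assms(2) consider "P' = (below (fst P) z, {h \<in> snd P. z \<preceq> h})"
    | "P' = (fst P - below (fst P) z, insert z {h \<in> snd P. \<not> z \<preceq> h})"
    by (auto simp: split_part_reach)
  then show ?thesis
    using True S boundary_below[OF S(1), of z] boundary_above[OF S(1), of z]
      subtree_below[OF S(1), of z] subtree_above[OF S(1), of z]
    by cases (simp_all add: valid_part_def)
next
  case False
  then show ?thesis
    using assms by (simp add: split_part_reach split: if_splits)
qed

lemma below_subset: "below S z \<subseteq> S"
  by (auto simp: below_def)

lemma split_part_sums:
  assumes "finite (fst P)"
  shows "(\<Sum>P'\<leftarrow>split_part reach P z. card (fst P')) = card (fst P)"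
    and "(\<Union>P'\<in>set (split_part reach P z). fst P') = fst P"
  using below_subset[of "fst P" z] card_mono[OF assms below_subset[of "fst P" z]]
    card_Diff_subset[OF finite_subset[OF below_subset assms], of z]
  by (auto simp: split_part_reach)

text \<open>The subtracted term counts the ordered pairs separated by the cut. It is zero when
  \<open>z\<close> is the top vertex and nothing is cut.\<close>

lemma pot_split_part:
  assumes "finite (fst P)" "z \<in> fst P"
  shows "(\<Sum>P'\<leftarrow>split_part reach P z. pot P') =
    pot P - 2 * real (card (below (fst P) z)) * (real (card (fst P)) - real (card (below (fst P) z)))"
proof -
  have eq: "real (card (fst P - below (fst P) z)) = real (card (fst P)) - real (card (below (fst P) z))"
    using card_Diff_subset[OF finite_subset[OF below_subset assms(1)], of z] card_mono[OF assms(1) below_subset[of "fst P" z]]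
    by (simp add: below_subset)
  then show ?thesis
    using assms(2) by (simp add: split_part_reach pot_def eq) (simp add: algebra_simps)
qed

lemma pot_split_part_le:
  assumes "finite (fst P)"
  shows "(\<Sum>P'\<leftarrow>split_part reach P z. pot P') \<le> pot P"
proof (cases "z \<in> fst P")
  case True
  have "0 \<le> 2 * real (card (below (fst P) z)) * (real (card (fst P)) - real (card (below (fst P) z)))"
    using card_mono[OF assms below_subset[of "fst P" z]] by (intro mult_nonneg_nonneg) auto
  then show ?thesis
    using pot_split_part[OF assms True] by simp
qed (simp add: split_part_reach)

lemma bottom_reach:
  assumes "z \<in> C" "\<forall>c\<in>C. c \<preceq> z"
  shows "bottom reach C = z"
  unfolding bottom_def using assms le_antisym by (intro some_equality) auto

text \<open>The lowest common ancestor \<open>z\<close> is the deepest vertex of the chain, so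
  restricting to vertices at or below a sample never loses it. A sample in \<open>T\<close> forces
  the deepest sample on the chain into \<open>T\<close>, and then everything left lies in
  \<open>T\<close>, short enough to be compared pairwise. The second alternative of the last premise
  covers a chain that is short from the start.\<close>

lemma pivot_eq_lca:
  assumes S: "subtree S" and z: "is_lca S x y z"
    and T: "T \<subseteq> {c \<in> S. c \<preceq> x \<and> c \<preceq> y}" "card T \<le> sample_size S"
      "\<And>r c. r \<in> T \<Longrightarrow> c \<in> S \<Longrightarrow> c \<preceq> x \<Longrightarrow> c \<preceq> y \<Longrightarrow> r \<preceq> c \<Longrightarrow> c \<in> T"
    and R: "set R \<inter> T \<noteq> {} \<or> card {c \<in> S. c \<preceq> x \<and> c \<preceq> y} \<le> sample_size S"
  shows "pivot reach ((S, H), ((x, y), R)) = z"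
proof -
  define w :: "'a part \<times> 'a pick" where "w = ((S, H), ((x, y), R))"
  define C where "C = {c \<in> S. c \<preceq> x \<and> c \<preceq> y}"
  have common: "common reach w = C" and samples: "samples reach w = set R \<inter> C"
    by (auto simp: C_def w_def)
  have fin: "finite C"
    using subtree_finite[OF S] by (simp add: C_def)
  have zC: "z \<in> C" "\<forall>c\<in>C. c \<preceq> z"
    using z by (auto simp: C_def is_lca_def)
  have low: "low reach w \<subseteq> C" "z \<in> low reach w \<and> card (low reach w) \<le> sample_size S"
  proof -
    show "low reach w \<subseteq> C"
      using common by auto
    show "z \<in> low reach w \<and> card (low reach w) \<le> sample_size S"
    proof (cases "samples reach w = {}")
      case True
      then have "low reach w = C"
        using common by simp
      moreover have "set R \<inter> T = {}"
        using True T(1) by (auto simp: samples C_def)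
      ultimately show ?thesis
        using R zC by (simp add: C_def)
    next
      case False
      have "\<exists>b\<in>samples reach w. \<forall>c\<in>samples reach w. c \<preceq> b"
      proof (rule chain_greatest)
        show "finite (samples reach w)" "samples reach w \<noteq> {}" "samples reach w \<subseteq> pverts G"
          using False fin subtree_verts[OF S] unfolding samples C_def by auto
        show "a \<preceq> b \<or> b \<preceq> a" if "a \<in> samples reach w" "b \<in> samples reach w" for a b
          using subtree_chain[OF S, of a b x] that unfolding samples C_def by simp
      qed
      then obtain b where b: "b \<in> samples reach w" "\<forall>c\<in>samples reach w. c \<preceq> b"
        by blast
      then have low_eq: "low reach w = {c \<in> C. b \<preceq> c}"
        using False common bottom_reach[OF b] by simp
      have "card (low reach w) \<le> sample_size S"
      proof (cases "set R \<inter> T = {}")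
        case True
        then have "card C \<le> sample_size S"
          using R by (simp add: C_def)
        moreover have "card (low reach w) \<le> card C"
          unfolding low_eq by (rule card_mono[OF fin]) auto
        ultimately show ?thesis
          by simp
      next
        case False
        then obtain r where r: "r \<in> set R" "r \<in> T"
          by blast
        then have "r \<preceq> b"
          using b(2) T(1) unfolding samples C_def by blast
        then have "low reach w \<subseteq> T"
          using T(3)[OF r(2)] le_trans[of r b] unfolding low_eq C_def by blast
        moreover have "finite T"
          using T(1) fin finite_subset unfolding C_def by blast
        ultimately show ?thesis
          using T(2) card_mono[of T "low reach w"] by linarith
      qed
      moreover have "z \<in> low reach w"
        using zC b(1) unfolding low_eq samples by blast
      ultimately show ?thesis by blast
    qed
  qed
  have "bottom reach (low reach w) = z"
    using low zC by (intro bottom_reach) blast+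
  with low show ?thesis
    by (simp add: w_def del: low.simps)
qed

lemma pair_pmf_bind: "pair_pmf A B = bind_pmf A (\<lambda>x. map_pmf (Pair x) B)"
  by (simp add: pair_pmf_def map_pmf_def)

text \<open>Goodness is judged by the pivot actually used, so a fallback that happens to be balanced
  counts as well.\<close>

definition good_picks :: "nat \<Rightarrow> 'a part \<Rightarrow> 'a pick set" where
  "good_picks d P = {s. pivot reach (P, s) \<in> fst P \<and>
     card (fst P) \<le> 8 * d * card (below (fst P) (pivot reach (P, s))) \<and>
     2 * card (below (fst P) (pivot reach (P, s))) \<le> card (fst P)}"

text \<open>Let \<open>T\<close> be the \<open>k\<close> deepest vertices of a long chain. All
  samples miss \<open>T\<close> with probability
  \<open>(1 - k/m)^k <= exp (- (k^2 / m)) <= exp (- 1) <= 1/2\<close>, where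
  \<open>m = card S\<close>. A chain of length at most \<open>k\<close> needs no hit.\<close>

lemma prob_samples_find_lca:
  assumes S: "subtree S" and xy: "(x, y) \<in> balanced_pairs d S"
  shows "1 / 2 \<le> measure_pmf.prob (replicate_pmf (sample_size S) (pmf_of_set S)) {R. ((x, y), R) \<in> good_picks d (S, H)}"
    (is "_ \<le> measure_pmf.prob ?p _")
proof -
  define k where "k = sample_size S"
  define C where "C = {c \<in> S. c \<preceq> x \<and> c \<preceq> y}"
  obtain z where z: "is_lca S x y z" "card S \<le> 8 * d * card (below S z)" "2 * card (below S z) \<le> card S"
    using xy by (auto simp: balanced_pairs_def)
  have good: "((x, y), R) \<in> good_picks d (S, H)" if "pivot reach ((S, H), ((x, y), R)) = z" for R
    using z that by (simp add: good_picks_def is_lca_def del: pivot.simps)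
  have finS: "finite S"
    by (rule subtree_finite[OF S])
  then have finC: "finite C"
    by (simp add: C_def)
  have neS: "S \<noteq> {}"
    using z by (auto simp: is_lca_def)
  show ?thesis
  proof (cases "card C \<le> k")
    case True
    have "pivot reach ((S, H), ((x, y), R)) = z" for R
      by (rule pivot_eq_lca[OF S z(1), of "{}"]) (use True in \<open>auto simp: C_def k_def\<close>)
    then have "{R. ((x, y), R) \<in> good_picks d (S, H)} = UNIV"
      using good by blast
    then show ?thesis by simp
  next
    case False
    have "\<exists>T\<subseteq>C. card T = k \<and> (\<forall>r\<in>T. \<forall>c\<in>C. r \<preceq> c \<longrightarrow> c \<in> T)"
    proof (rule chain_upper_segment[OF finC])
      show "C \<subseteq> pverts G" "k \<le> card C"
        using False subtree_verts[OF S] by (auto simp: C_def)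
      show "a \<preceq> b \<or> b \<preceq> a" if "a \<in> C" "b \<in> C" for a b
        using subtree_chain[OF S, of a b x] that by (simp add: C_def)
    qed
    then obtain T where T: "T \<subseteq> C" "card T = k" "\<forall>r\<in>T. \<forall>c\<in>C. r \<preceq> c \<longrightarrow> c \<in> T"
      by blast
    have "pivot reach ((S, H), ((x, y), R)) = z" if "\<not> set R \<subseteq> - T" for R
      by (rule pivot_eq_lca[OF S z(1), of T]) (use T that in \<open>auto simp: C_def k_def\<close>)
    then have "- {R. set R \<subseteq> - T} \<subseteq> {R. ((x, y), R) \<in> good_picks d (S, H)}"
      using good by blast
    then have "measure_pmf.prob ?p (- {R. set R \<subseteq> - T}) \<le> measure_pmf.prob ?p {R. ((x, y), R) \<in> good_picks d (S, H)}"
      by (intro measure_pmf.finite_measure_mono) auto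
    moreover have "measure_pmf.prob ?p (- {R. set R \<subseteq> - T}) = 1 - measure_pmf.prob ?p {R. set R \<subseteq> - T}"
      using measure_pmf.prob_compl[of "{R. set R \<subseteq> - T}" ?p] by (simp add: Compl_eq_Diff_UNIV)
    moreover have "measure_pmf.prob ?p {R. set R \<subseteq> - T} \<le> 1 / 2"
    proof -
      define m where "m = real (card S)"
      have m: "0 < m"
        using finS neS by (simp add: m_def card_gt_0_iff)
      have TS: "T \<subseteq> S"
        using T(1) by (auto simp: C_def)
      then have "k \<le> card S"
        using card_mono[OF finS TS] T(2) by simp
      have "card (S \<inter> - T) = card S - k"
        using T(2) card_Diff_subset[OF finite_subset[OF TS finS] TS] by (simp add: Diff_eq)
      then have "measure_pmf.prob (pmf_of_set S) (- T) = 1 - real k / m"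
        using finS neS \<open>k \<le> card S\<close> m by (simp add: measure_pmf_of_set m_def of_nat_diff field_simps)
      moreover have "1 - real k / m \<le> exp (- (real k / m))"
        using exp_ge_add_one_self[of "- (real k / m)"] by simp
      moreover have "0 \<le> 1 - real k / m"
        using \<open>k \<le> card S\<close> m by (simp add: m_def)
      ultimately have "measure_pmf.prob ?p {R. set R \<subseteq> - T} \<le> exp (- (real k / m)) ^ k"
        unfolding prob_replicate_pmf_subset k_def[symmetric] by (simp add: power_mono)
      also have "\<dots> = exp (- ((real k)\<^sup>2 / m))"
        by (simp add: exp_of_nat_mult[symmetric] power2_eq_square)
      also have "\<dots> \<le> exp (- 1)"
      proof -
        have "m \<le> (real k)\<^sup>2"
          using le_sample_size_sq[of S] unfolding m_def k_def by (metis of_nat_le_iff of_nat_power)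
        then show ?thesis
          using m by simp
      qed
      also have "exp (- 1) \<le> 1 / (2 :: real)"
        using exp_ge_add_one_self[of 1] by (simp add: exp_minus field_simps)
      finally show ?thesis .
    qed
    ultimately show ?thesis
      by linarith
  qed
qed

text \<open>The pair is balanced with probability at least \<open>1 / (32 * d^2)\<close> by
  \<open>card_balanced_pairs\<close>, and for each balanced pair the independently drawn samples
  succeed with probability at least one half.\<close>

lemma prob_good_picks:
  assumes S: "subtree S" and two: "2 \<le> card S" and d: "1 \<le> d"
    and deg: "\<And>v. card {h. (v, h) \<in> parcs G} \<le> d"
  shows "1 / (64 * real d ^ 2) \<le> measure_pmf.prob (pick_pmf (S, H)) (good_picks d (S, H))"
proof -
  have fin: "finite S" and ne: "S \<noteq> {}"
    using subtree_finite[OF S] two by auto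
  let ?U = "pmf_of_set (S \<times> S)" and ?R = "replicate_pmf (sample_size S) (pmf_of_set S)"
  let ?B = "balanced_pairs d S"
  have finU: "finite (set_pmf ?U)"
    using fin ne by (simp add: set_pmf_of_set)
  have "?B \<subseteq> S \<times> S"
    by (auto simp: balanced_pairs_def)
  then have eq: "measure_pmf.prob ?U ?B = real (card ?B) / (real (card S))\<^sup>2"
    using fin ne by (simp add: measure_pmf_of_set Int_absorb1 card_cartesian_product power2_eq_square)
  have "(real (card S))\<^sup>2 \<le> 32 * (real d)\<^sup>2 * real (card ?B)"
  proof -
    have "real ((card S)\<^sup>2) \<le> real (32 * d\<^sup>2 * card ?B)"
      using card_balanced_pairs[OF S two deg] by (simp only: of_nat_le_iff)
    then show ?thesis by simp
  qed
  then have "1 / (32 * (real d)\<^sup>2) \<le> measure_pmf.prob ?U ?B"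
    unfolding eq using d fin ne by (simp add: field_simps)
  then have "1 / (64 * (real d)\<^sup>2) \<le> measure_pmf.prob ?U ?B * (1 / 2)"
    by simp
  also have "\<dots> = measure_pmf.expectation ?U (\<lambda>xy. indicator ?B xy * (1 / 2))"
    by simp
  also have "\<dots> \<le> measure_pmf.expectation ?U (\<lambda>xy. measure_pmf.prob ?R {R. (xy, R) \<in> good_picks d (S, H)})"
    using prob_samples_find_lca[OF S, of _ _ d H]
    by (intro integral_mono integrable_measure_pmf_finite finU) (auto simp: indicator_def)
  also have "\<dots> = measure_pmf.prob (pick_pmf (S, H)) (good_picks d (S, H))"
    by (simp add: pick_pmf_def pair_pmf_bind measure_bind_pmf_eq vimage_def)
  finally show ?thesis .
qed

text \<open>A good pick separates \<open>b >= m / (8 * d)\<close> vertices from at least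
  \<open>m / 2\<close> others, so the drop \<open>2 * b * (m - b)\<close> is at least
  \<open>m^2 / (8 * d)\<close>, the value called \<open>gain\<close>. Multiplying by the probability
  \<open>1 / (64 * d^2)\<close> and using \<open>pot P <= m^2\<close> gives the rate
  \<open>1 / (512 * d^3)\<close>. A singleton has no potential to lose.\<close>

lemma expectation_pot_split_part:
  assumes P: "valid_part P" and d: "1 \<le> d"
    and deg: "\<And>v. card {h. (v, h) \<in> parcs G} \<le> d"
  shows "measure_pmf.expectation (pick_pmf P) (\<lambda>s. \<Sum>P'\<leftarrow>split_part reach P (pivot reach (P, s)). pot P')
    \<le> (1 - 1 / (512 * real d ^ 3)) * pot P"
proof -
  define S where "S = fst P"
  define m where "m = real (card S)"
  define gain where "gain = m\<^sup>2 / (8 * real d)"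
  have S: "subtree S"
    using P by (simp add: valid_part_def S_def)
  have fin: "finite S" and ne: "S \<noteq> {}"
    using subtree_finite[OF S] S by (auto simp: subtree_def)
  have finP: "finite (set_pmf (pick_pmf P))"
    using fin ne by (intro finite_pick_pmf) (simp_all add: S_def)
  have drop: "(\<Sum>P'\<leftarrow>split_part reach P (pivot reach (P, s)). pot P') \<le> pot P - gain * indicator (good_picks d P) s" for s
  proof (cases "s \<in> good_picks d P")
    case False
    then show ?thesis
      using pot_split_part_le[of P] fin by (simp add: S_def del: pivot.simps)
  next
    case True
    define z where "z = pivot reach (P, s)"
    define b where "b = real (card (below S z))"
    have z: "z \<in> S" "card S \<le> 8 * d * card (below S z)" "2 * card (below S z) \<le> card S"
      using True by (auto simp: good_picks_def z_def S_def simp del: pivot.simps)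
    have "real (card S) \<le> real (8 * d * card (below S z))" "real (2 * card (below S z)) \<le> real (card S)"
      using z(2,3) by (simp_all only: of_nat_le_iff)
    then have "m \<le> 8 * real d * b" "2 * b \<le> m"
      by (simp_all add: m_def b_def)
    then have "(m / (8 * real d)) * m \<le> b * (2 * (m - b))"
      using d by (intro mult_mono) (simp_all add: field_simps m_def b_def)
    then have "gain \<le> 2 * b * (m - b)"
      by (simp add: gain_def power2_eq_square algebra_simps)
    then show ?thesis
      using pot_split_part[of P z] fin z(1) True by (simp add: S_def[symmetric] z_def[symmetric] m_def b_def)
  qed
  have "measure_pmf.expectation (pick_pmf P) (\<lambda>s. \<Sum>P'\<leftarrow>split_part reach P (pivot reach (P, s)). pot P')
      \<le> measure_pmf.expectation (pick_pmf P) (\<lambda>s. pot P - gain * indicator (good_picks d P) s)"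
    using drop by (intro integral_mono integrable_measure_pmf_finite finP)
  also have "\<dots> = pot P - gain * measure_pmf.prob (pick_pmf P) (good_picks d P)"
    by (simp add: Bochner_Integration.integral_diff integrable_measure_pmf_finite finP)
  also have "\<dots> \<le> (1 - 1 / (512 * real d ^ 3)) * pot P"
  proof (cases "2 \<le> card S")
    case True
    have "pot P \<le> m\<^sup>2"
      unfolding pot_def m_def S_def power2_eq_square by (intro mult_left_mono) auto
    then have "pot P * (1 / (512 * real d ^ 3)) \<le> m\<^sup>2 * (1 / (512 * real d ^ 3))"
      by (rule mult_right_mono) simp
    also have "\<dots> = gain * (1 / (64 * real d ^ 2))"
      by (simp add: gain_def power2_eq_square power3_eq_cube)
    also have "\<dots> \<le> gain * measure_pmf.prob (pick_pmf P) (good_picks d P)"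
      using prob_good_picks[OF S True d deg, of "snd P"] by (intro mult_left_mono) (simp_all add: S_def gain_def)
    finally show ?thesis
      by (simp add: algebra_simps)
  next
    case False
    then have "card S = 1"
      using fin ne by (metis One_nat_def card_gt_0_iff less_2_cases not_less less_numeral_extra(3))
    then have "pot P = 0"
      by (simp add: pot_def S_def)
    then show ?thesis
      by (simp add: gain_def)
  qed
  finally show ?thesis .
qed

end

section \<open>The algorithm and its failure probability\<close>

primrec learn :: "nat \<Rightarrow> 'a part list \<Rightarrow> ('a part list \<Rightarrow> 'a query_alg) \<Rightarrow> 'a query_alg" where
  "learn 0 Ps k = k Ps"
| "learn (Suc t) Ps k = level Ps (\<lambda>Ps'. learn t Ps' k)"

text \<open>The argument \<open>A\<close> carries the ancestors of \<open>v\<close> learned from the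
  preceding batch, so one step costs one batch. Nothing tests whether a root has been reached;
  \<open>t\<close> is simply taken large enough.\<close>

primrec find_root :: "'a set \<Rightarrow> nat \<Rightarrow> 'a \<Rightarrow> 'a set \<Rightarrow> ('a \<Rightarrow> 'a query_alg) \<Rightarrow> 'a query_alg" where
  "find_root V 0 v A k = k v"
| "find_root V (Suc t) v A k =
     Sample (map_pmf (\<lambda>u. ask (V \<times> {u}) (\<lambda>X. find_root V t u (fst ` X) k)) (pmf_of_set A))"

text \<open>The product is intended for parts with singleton first component, where the boundary
  consists of the out-neighbours.\<close>

definition arcs_of :: "'a part list \<Rightarrow> ('a \<times> 'a) set" where
  "arcs_of Ps = (\<Union>P\<in>set Ps. fst P \<times> snd P)"

text \<open>The number of roots is unknown, so \<open>m\<close> is mere fuel and the loop ends when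
  \<open>U\<close> is empty. Descendants of \<open>r\<close> are taken in all of \<open>V\<close>,
  including those already removed: this set has no leaving arcs, so learning starts with an empty
  boundary.\<close>

primrec cover :: "'a set \<Rightarrow> nat \<Rightarrow> nat \<Rightarrow> 'a set \<Rightarrow> ('a \<times> 'a) set \<Rightarrow> 'a query_alg" where
  "cover V t 0 U E = Output E"
| "cover V t (Suc m) U E = (if U = {} then Output E
     else ask (V \<times> {SOME v. v \<in> U}) (\<lambda>X. find_root V t (SOME v. v \<in> U) (fst ` X)
       (\<lambda>r. ask ({r} \<times> V) (\<lambda>Y. learn t [(snd ` Y, {})]
         (\<lambda>Ps. cover V t m (U - snd ` Y) (E \<union> arcs_of Ps))))))"

lemma drop_rate_le_half:
  assumes "1 \<le> d"
  shows "1 / (512 * real d ^ 3) \<le> 1 / 2"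
proof (rule frac_le)
  have "1 \<le> real d ^ 3"
    using assms by simp
  then show "2 \<le> 512 * real d ^ 3"
    by linarith
qed simp_all

lemma sum_list_concat_map:
  fixes f :: "'b \<Rightarrow> 'c :: comm_monoid_add"
  shows "(\<Sum>y\<leftarrow>concat (map g xs). f y) = (\<Sum>x\<leftarrow>xs. \<Sum>y\<leftarrow>g x. f y)"
  by (induction xs) auto

section \<open>Failure bounds for learning a tree, finding a root and covering all vertices\<close>

context multitree
begin

text \<open>Bounded out-degree keeps the boundary linear in the part, and with it the batch that
  filters the boundary.\<close>

lemma valid_part_facts:
  assumes P: "valid_part P" and deg: "\<And>v. card {h. (v, h) \<in> parcs G} \<le> d"
  shows "finite (fst P)" "fst P \<noteq> {}" "finite (snd P)" "card (snd P) \<le> d * card (fst P)"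
proof -
  have S: "subtree (fst P)" "snd P = boundary (fst P)"
    using P by (auto simp: valid_part_def)
  show fin: "finite (fst P)"
    by (rule subtree_finite[OF S(1)])
  show "fst P \<noteq> {}"
    using S(1) unfolding subtree_def by blast
  have sub: "snd P \<subseteq> (\<Union>s\<in>fst P. {h. (s, h) \<in> parcs G})"
    by (auto simp: S(2) boundary_def)
  have fins: "finite {h. (s, h) \<in> parcs G}" for s
    by (rule finite_subset[OF _ pair_finite_verts]) (auto dest: in_arcsD2)
  then have finU: "finite (\<Union>s\<in>fst P. {h. (s, h) \<in> parcs G})"
    using fin by blast
  then show "finite (snd P)"
    using sub by (rule rev_finite_subset)
  have "card (snd P) \<le> card (\<Union>s\<in>fst P. {h. (s, h) \<in> parcs G})"
    using sub by (rule card_mono[OF finU])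
  also have "\<dots> \<le> (\<Sum>s\<in>fst P. card {h. (s, h) \<in> parcs G})"
    by (rule card_UN_le[OF fin])
  also have "\<dots> \<le> card (fst P) * d"
    using sum_bounded_above[of "fst P" "\<lambda>s. card {h. (s, h) \<in> parcs G}" d] deg by simp
  finally show "card (snd P) \<le> d * card (fst P)"
    by (simp add: mult.commute)
qed

lemma pot_nonneg: "0 \<le> pot P"
  by (cases "card (fst P)") (simp_all add: pot_def)

lemma refine_reach:
  assumes L: "map fst L = Ps" and valid: "\<And>P. P \<in> set Ps \<Longrightarrow> valid_part P"
  shows "\<And>P. P \<in> set (refine reach L) \<Longrightarrow> valid_part P"
    and "(\<Sum>P\<leftarrow>refine reach L. card (fst P)) = (\<Sum>P\<leftarrow>Ps. card (fst P))"
    and "(\<Union>P\<in>set (refine reach L). fst P) = (\<Union>P\<in>set Ps. fst P)"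
proof -
  have mem: "valid_part (fst w)" "finite (fst (fst w))" if "w \<in> set L" for w
  proof -
    show "valid_part (fst w)"
      using valid that by (auto simp flip: L)
    then show "finite (fst (fst w))"
      by (simp add: valid_part_def subtree_finite)
  qed
  show "valid_part P" if "P \<in> set (refine reach L)" for P
  proof -
    obtain w where "w \<in> set L" "P \<in> set (split_part reach (fst w) (pivot reach w))"
      using \<open>P \<in> set (refine reach L)\<close> by (auto simp: refine_def)
    then show ?thesis
      using mem split_part_valid by blast
  qed
  have "(\<Sum>P\<leftarrow>refine reach L. card (fst P)) = (\<Sum>w\<leftarrow>L. card (fst (fst w)))"
    unfolding refine_def sum_list_concat_map
    using mem by (intro arg_cong[where f = sum_list] map_cong refl split_part_sums) auto
  also have "\<dots> = (\<Sum>P\<leftarrow>Ps. card (fst P))"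
    by (simp add: o_def flip: L)
  finally show "(\<Sum>P\<leftarrow>refine reach L. card (fst P)) = (\<Sum>P\<leftarrow>Ps. card (fst P))" .
  have "(\<Union>P\<in>set (refine reach L). fst P) = (\<Union>w\<in>set L. \<Union>P\<in>set (split_part reach (fst w) (pivot reach w)). fst P)"
    by (simp add: refine_def)
  also have "\<dots> = (\<Union>w\<in>set L. fst (fst w))"
    using mem by (intro SUP_cong refl split_part_sums)
  also have "\<dots> = (\<Union>P\<in>set Ps. fst P)"
    by (simp flip: L)
  finally show "(\<Union>P\<in>set (refine reach L). fst P) = (\<Union>P\<in>set Ps. fst P)" .
qed

lemma expectation_pot_refine:
  assumes valid: "\<And>P. P \<in> set Ps \<Longrightarrow> valid_part P" and d: "1 \<le> d"
    and deg: "\<And>v. card {h. (v, h) \<in> parcs G} \<le> d"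
  shows "measure_pmf.expectation (label_pmf pick_pmf Ps) (\<lambda>L. \<Sum>P\<leftarrow>refine reach L. pot P)
    \<le> (1 - 1 / (512 * real d ^ 3)) * (\<Sum>P\<leftarrow>Ps. pot P)"
proof -
  have fin: "finite (set_pmf (pick_pmf P))" if "P \<in> set Ps" for P
    using valid_part_facts[OF valid[OF that] deg] by (intro finite_pick_pmf)
  have "measure_pmf.expectation (label_pmf pick_pmf Ps) (\<lambda>L. \<Sum>P\<leftarrow>refine reach L. pot P) =
      (\<Sum>P\<leftarrow>Ps. measure_pmf.expectation (pick_pmf P) (\<lambda>s. \<Sum>P'\<leftarrow>split_part reach P (pivot reach (P, s)). pot P'))"
    unfolding refine_def sum_list_concat_map
    using expectation_label_pmf[OF fin, where f = "\<lambda>w. \<Sum>P'\<leftarrow>split_part reach (fst w) (pivot reach w). pot P'"]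
    by (simp del: pivot.simps)
  also have "\<dots> \<le> (\<Sum>P\<leftarrow>Ps. (1 - 1 / (512 * real d ^ 3)) * pot P)"
    using expectation_pot_split_part[OF valid d deg] by (intro sum_list_mono)
  also have "\<dots> = (1 - 1 / (512 * real d ^ 3)) * (\<Sum>P\<leftarrow>Ps. pot P)"
    by (simp add: sum_list_const_mult)
  finally show ?thesis .
qed

text \<open>Markov's inequality is built into the base case: if some part is not a singleton, the
  potential is at least 1 and the bound is trivial. The induction step averages this bound over one
  level, which multiplies the potential by the drop factor.\<close>

lemma fail_learn:
  assumes d: "1 \<le> d" and deg: "\<And>v. card {h. (v, h) \<in> parcs G} \<le> d" and \<beta>: "0 \<le> \<beta>"
    and valid: "\<And>P. P \<in> set Ps \<Longrightarrow> valid_part P" and N: "(\<Sum>P\<leftarrow>Ps. card (fst P)) \<le> N"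
    and k: "\<And>Ps'. (\<And>P. P \<in> set Ps' \<Longrightarrow> valid_part P \<and> card (fst P) = 1) \<Longrightarrow>
      (\<Union>P\<in>set Ps'. fst P) = (\<Union>P\<in>set Ps. fst P) \<Longrightarrow> fail (path_query G) E q r (k Ps') \<le> \<beta>"
  shows "fail (path_query G) E (t * ((12 + d) * N) + q) (t * 4 + r) (learn t Ps k)
    \<le> (1 - 1 / (512 * real d ^ 3)) ^ t * (\<Sum>P\<leftarrow>Ps. pot P) + \<beta>"
  using valid N k
proof (induction t arbitrary: Ps)
  case 0
  show ?case
  proof (cases "\<forall>P\<in>set Ps. card (fst P) = 1")
    case True
    then have "fail (path_query G) E q r (k Ps) \<le> \<beta>"
      using 0 by blast
    moreover have "0 \<le> (\<Sum>P\<leftarrow>Ps. pot P)"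
      by (intro sum_list_nonneg) (auto simp: pot_nonneg)
    ultimately show ?thesis
      by simp
  next
    case False
    then obtain P where P: "P \<in> set Ps" "card (fst P) \<noteq> 1"
      by blast
    then have "2 \<le> card (fst P)"
      using valid_part_facts[OF 0(1) deg, of P] by (metis One_nat_def card_gt_0_iff less_2_cases_iff not_less less_numeral_extra(3))
    then have "2 * 1 \<le> pot P"
      unfolding pot_def by (intro mult_mono) auto
    moreover have "pot P \<le> (\<Sum>P\<leftarrow>Ps. pot P)"
    proof -
      obtain xs ys where "Ps = xs @ P # ys"
        using P(1) split_list by metis
      moreover have "0 \<le> (\<Sum>P\<leftarrow>xs. pot P)" "0 \<le> (\<Sum>P\<leftarrow>ys. pot P)"
        by (intro sum_list_nonneg; auto simp: pot_nonneg)+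
      ultimately show ?thesis
        by simp
    qed
    ultimately have "1 \<le> (\<Sum>P\<leftarrow>Ps. pot P) + \<beta>"
      using \<beta> by linarith
    then show ?thesis
      by (simp add: order_trans[OF fail_le_1])
  qed
next
  case (Suc t)
  define c where "c = 1 - 1 / (512 * real d ^ 3)"
  have c: "0 \<le> c"
    using drop_rate_le_half[OF d] by (simp add: c_def)
  let ?M = "label_pmf pick_pmf Ps"
  have fin: "finite (set_pmf ?M)"
    using valid_part_facts[OF Suc.prems(1) deg] by (intro finite_label_pmf finite_pick_pmf)
  have "fail (path_query G) E (Suc t * ((12 + d) * N) + q) (Suc t * 4 + r) (learn (Suc t) Ps k) =
     fail (path_query G) E ((12 + d) * N + (t * ((12 + d) * N) + q)) (4 + (t * 4 + r)) (level Ps (\<lambda>Ps'. learn t Ps' k))"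
    by (simp add: algebra_simps)
  also have "\<dots> \<le> measure_pmf.expectation ?M
      (\<lambda>L. fail (path_query G) E (t * ((12 + d) * N) + q) (t * 4 + r) (learn t (refine reach L) k))"
    using valid_part_facts[OF Suc.prems(1) deg] Suc.prems(2) by (intro fail_level) auto
  also have "\<dots> \<le> measure_pmf.expectation ?M (\<lambda>L. c ^ t * (\<Sum>P\<leftarrow>refine reach L. pot P) + \<beta>)"
  proof (intro integral_mono_AE integrable_measure_pmf_finite fin)
    show "AE L in ?M. fail (path_query G) E (t * ((12 + d) * N) + q) (t * 4 + r) (learn t (refine reach L) k)
        \<le> c ^ t * (\<Sum>P\<leftarrow>refine reach L. pot P) + \<beta>"
      unfolding AE_measure_pmf_iff
    proof
      fix L assume "L \<in> set_pmf ?M"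
      then have "map fst L = Ps"
        by (rule set_label_pmf)
      note R = refine_reach[OF this Suc.prems(1)]
      show "fail (path_query G) E (t * ((12 + d) * N) + q) (t * 4 + r) (learn t (refine reach L) k)
        \<le> c ^ t * (\<Sum>P\<leftarrow>refine reach L. pot P) + \<beta>"
        unfolding c_def
      proof (rule Suc.IH)
        show "valid_part P" if "P \<in> set (refine reach L)" for P
          using R(1) that by blast
        show "(\<Sum>P\<leftarrow>refine reach L. card (fst P)) \<le> N"
          using R(2) Suc.prems(2) by simp
        show "fail (path_query G) E q r (k Ps') \<le> \<beta>"
          if "\<And>P. P \<in> set Ps' \<Longrightarrow> valid_part P \<and> card (fst P) = 1"
            "(\<Union>P\<in>set Ps'. fst P) = (\<Union>P\<in>set (refine reach L). fst P)" for Ps'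
          using Suc.prems(3)[of Ps'] that R(3) by simp
      qed
    qed
  qed
  also have "\<dots> = c ^ t * measure_pmf.expectation ?M (\<lambda>L. \<Sum>P\<leftarrow>refine reach L. pot P) + \<beta>"
    by (subst Bochner_Integration.integral_add) (simp_all add: integrable_measure_pmf_finite fin)
  also have "\<dots> \<le> c ^ t * (c * (\<Sum>P\<leftarrow>Ps. pot P)) + \<beta>"
    using expectation_pot_refine[OF Suc.prems(1) d deg] c by (intro add_right_mono mult_left_mono) (auto simp: c_def)
  finally show ?case
    by (simp add: c_def mult.assoc mult.left_commute)
qed

text \<open>Ancestors of members of \<open>A\<close> lie in \<open>A\<close> by transitivity. The
  set \<open>X\<close> of strictly comparable pairs is disjoint from its converse by antisymmetry,
  so it fills at most half of the off-diagonal pairs.\<close>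

lemma ancestors_sum_le:
  assumes v: "v \<in> pverts G" and A: "A = {u. u \<preceq> v}"
  shows "(\<Sum>u\<in>A. real (card {w. w \<preceq> u}) - 1) \<le> real (card A) * (real (card A) - 1) / 2"
proof -
  define X where "X = (SIGMA u:A. {w. w \<preceq> u} - {u})"
  have fin: "finite A" "\<And>u. finite {w. w \<preceq> u}"
    by (simp_all add: A finite_verts_above)
  have "card {w. w \<preceq> u} = Suc (card ({w. w \<preceq> u} - {u}))" if "u \<in> A" for u
    using that le_verts le_refl fin(2)[of u] unfolding A by (subst card.remove[of _ u]) auto
  then have "(\<Sum>u\<in>A. real (card {w. w \<preceq> u}) - 1) = (\<Sum>u\<in>A. real (card ({w. w \<preceq> u} - {u})))"
    by simp
  also have "\<dots> = real (card X)"
    using fin unfolding X_def by simp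
  finally have eq: "(\<Sum>u\<in>A. real (card {w. w \<preceq> u}) - 1) = real (card X)" .
  have X: "X \<subseteq> A \<times> A - Id_on A"
    using le_trans unfolding X_def A by auto
  have finX: "finite X"
    using finite_subset[OF X] fin by simp
  have "X \<inter> X\<inverse> = {}"
    using le_antisym unfolding X_def by auto
  then have "card X + card (X\<inverse>) = card (X \<union> X\<inverse>)"
    using finX by (simp add: card_Un_disjoint)
  also have "\<dots> \<le> card (A \<times> A - Id_on A)"
    using X fin by (intro card_mono) auto
  also have "\<dots> = card A * card A - card A"
  proof -
    have "Id_on A = (\<lambda>a. (a, a)) ` A"
      by auto
    then have "card (Id_on A) = card A"
      by (simp add: card_image inj_on_def)
    then show ?thesis
      using fin by (subst card_Diff_subset) (auto simp: card_cartesian_product intro: finite_subset[of _ "A \<times> A"])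
  qed
  finally have "2 * card X \<le> card A * card A - card A"
    by (simp add: card_inverse)
  then have "real (2 * card X) \<le> real (card A * card A - card A)"
    by (simp only: of_nat_le_iff)
  then have "2 * real (card X) \<le> real (card A) * real (card A) - real (card A)"
    by (simp add: of_nat_diff)
  then show ?thesis
    unfolding eq by (simp add: algebra_simps)
qed

lemma rootI:
  assumes "v \<in> pverts G" "card {u. u \<preceq> v} = 1"
  shows "v \<in> roots G"
proof -
  have "v \<in> {u. u \<preceq> v}"
    using le_refl[OF assms(1)] by simp
  then have "{u. u \<preceq> v} = {v}"
    using assms(2) by (metis card_1_singletonE singletonD)
  then have "in_arcs G v = {}"
    using arc_le arc_neq unfolding in_arcs_def by auto
  then show ?thesis
    using assms(1) by (simp add: roots_def in_degree_def)
qed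

text \<open>An ancestor of \<open>v\<close> with the fewest ancestors has none besides
  itself.\<close>

lemma root_exists:
  assumes "v \<in> pverts G"
  shows "\<exists>r\<in>roots G. r \<preceq> v"
proof -
  obtain r where r: "r \<preceq> v" and min: "\<And>u. u \<preceq> v \<Longrightarrow> card {w. w \<preceq> r} \<le> card {w. w \<preceq> u}"
    using ex_has_least_nat[of "\<lambda>u. u \<preceq> v" v "\<lambda>u. card {w. w \<preceq> u}"] le_refl[OF assms] by blast
  have rG: "r \<in> pverts G"
    using r le_verts by blast
  have "{w. w \<preceq> r} \<subseteq> {r}"
  proof
    fix u assume "u \<in> {w. w \<preceq> r}"
    then have u: "u \<preceq> r" by simp
    have "{w. w \<preceq> u} \<subseteq> {w. w \<preceq> r}"
      using u le_trans by blast
    moreover have "card {w. w \<preceq> r} \<le> card {w. w \<preceq> u}"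
      using min u r le_trans by blast
    ultimately have "{w. w \<preceq> u} = {w. w \<preceq> r}"
      by (intro card_seteq finite_verts_above)
    then have "r \<preceq> u"
      using le_refl[OF rG] by blast
    then show "u \<in> {r}"
      using u le_antisym by blast
  qed
  then have "{w. w \<preceq> r} = {r}"
    using le_refl[OF rG] by blast
  then have "card {w. w \<preceq> r} = 1"
    by simp
  then show ?thesis
    using rootI rG r by blast
qed

lemma ancestors_query: "fst ` {q \<in> pverts G \<times> {u}. path_query G q} = {w. w \<preceq> u}"
proof -
  have "{q \<in> pverts G \<times> {u}. path_query G q} = {w. w \<preceq> u} \<times> {u}"
    by (auto dest: le_verts)
  then show ?thesis by simp
qed

lemma descendants_query: "snd ` {q \<in> {r} \<times> pverts G. path_query G q} = {u. r \<preceq> u}"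
proof -
  have "{q \<in> {r} \<times> pverts G. path_query G q} = {r} \<times> {u. r \<preceq> u}"
    by (auto dest: le_verts)
  then show ?thesis by simp
qed

text \<open>The number of proper ancestors plays the role of a potential: it is zero only at roots
  and otherwise bounds the failure probability trivially. By \<open>ancestors_sum_le\<close>,
  passing to a uniformly drawn ancestor halves it in expectation.\<close>

lemma fail_find_root:
  assumes v: "v \<in> pverts G" and \<beta>: "0 \<le> \<beta>"
    and k: "\<And>s. s \<in> roots G \<Longrightarrow> s \<preceq> v \<Longrightarrow> fail (path_query G) E q r (k s) \<le> \<beta>"
  shows "fail (path_query G) E (t * card (pverts G) + q) (t + r) (find_root (pverts G) t v {u. u \<preceq> v} k)
    \<le> (1 / 2) ^ t * (real (card {u. u \<preceq> v}) - 1) + \<beta>"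
  using v k
proof (induction t arbitrary: v)
  case 0
  have "0 < card {u. u \<preceq> v}"
    using le_refl[OF 0(1)] finite_verts_above by (auto simp: card_gt_0_iff)
  then consider "card {u. u \<preceq> v} = 1" | "2 \<le> card {u. u \<preceq> v}"
    by linarith
  then show ?case
  proof cases
    case 1
    then show ?thesis
      using 0 rootI le_refl by simp
  next
    case 2
    then have "1 \<le> real (card {u. u \<preceq> v}) - 1 + \<beta>"
      using \<beta> by linarith
    then show ?thesis
      by (simp add: order_trans[OF fail_le_1])
  qed
next
  case (Suc t)
  define n where "n = card (pverts G)"
  define A where "A = {u. u \<preceq> v}"
  have A: "finite A" "A \<noteq> {}"
    using le_refl[OF Suc.prems(1)] finite_verts_above by (auto simp: A_def)
  have "fail (path_query G) E (Suc t * n + q) (Suc t + r) (find_root (pverts G) (Suc t) v A k)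
    \<le> measure_pmf.expectation (pmf_of_set A) (\<lambda>u. (1 / 2) ^ t * (real (card {w. w \<preceq> u}) - 1) + \<beta>)"
    unfolding find_root.simps
  proof (rule fail_Sample_le)
    show "finite (set_pmf (pmf_of_set A))"
      using A by simp
    fix u assume "u \<in> set_pmf (pmf_of_set A)"
    then have u: "u \<preceq> v" "u \<in> pverts G"
      using A le_verts by (auto simp: A_def)
    have "fail (path_query G) E (Suc t * n + q) (Suc t + r) (ask (pverts G \<times> {u}) (\<lambda>X. find_root (pverts G) t u (fst ` X) k))
      = fail (path_query G) E (n + (t * n + q)) (Suc (t + r)) (ask (pverts G \<times> {u}) (\<lambda>X. find_root (pverts G) t u (fst ` X) k))"
      by (simp add: algebra_simps)
    also have "\<dots> \<le> fail (path_query G) E (t * n + q) (t + r) (find_root (pverts G) t u {w. w \<preceq> u} k)"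
      unfolding ancestors_query[symmetric] using pair_finite_verts by (intro fail_ask) (simp_all add: n_def card_cartesian_product)
    also have "\<dots> \<le> (1 / 2) ^ t * (real (card {w. w \<preceq> u}) - 1) + \<beta>"
      unfolding n_def using u Suc.prems(2) le_trans by (intro Suc.IH) blast+
    finally show "fail (path_query G) E (Suc t * n + q) (Suc t + r) (ask (pverts G \<times> {u}) (\<lambda>X. find_root (pverts G) t u (fst ` X) k))
      \<le> (1 / 2) ^ t * (real (card {w. w \<preceq> u}) - 1) + \<beta>" .
  qed
  also have "\<dots> = (1 / 2) ^ t * ((\<Sum>u\<in>A. real (card {w. w \<preceq> u}) - 1) / real (card A)) + \<beta>"
    using A by (simp add: integral_pmf_of_set sum.distrib sum_distrib_left[symmetric] add_divide_distrib)
  also have "\<dots> \<le> (1 / 2) ^ t * ((real (card A) * (real (card A) - 1) / 2) / real (card A)) + \<beta>"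
    using ancestors_sum_le[OF Suc.prems(1) A_def]
    by (intro add_right_mono mult_left_mono divide_right_mono) auto
  also have "\<dots> = (1 / 2) ^ Suc t * (real (card A) - 1) + \<beta>"
    using A by simp
  finally show ?case
    by (simp add: A_def n_def)
qed

lemma arcs_of_singletons:
  assumes "\<And>P. P \<in> set Ps \<Longrightarrow> valid_part P \<and> card (fst P) = 1"
  shows "arcs_of Ps = {(s, h) \<in> parcs G. s \<in> (\<Union>P\<in>set Ps. fst P)}"
proof -
  have "fst P \<times> snd P = {(s, h) \<in> parcs G. s \<in> fst P}" if P: "P \<in> set Ps" for P
  proof -
    obtain v where "fst P = {v}"
      using assms[OF P] by (metis card_1_singletonE)
    moreover have "snd P = boundary (fst P)"
      using assms[OF P] by (simp add: valid_part_def)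
    ultimately show ?thesis
      using arc_neq by (auto simp: boundary_def)
  qed
  then show ?thesis
    unfolding arcs_of_def by blast
qed

text \<open>Costs and failure probability are charged per root left in \<open>U\<close>, not per
  unit of \<open>m\<close>, so generous fuel is free. Since \<open>U\<close> is closed under
  ancestors, a root found above a vertex of \<open>U\<close> lies in \<open>U\<close>, and its
  removal lowers the count. The summand 2 in \<open>\<rho>\<close> stands for the batch giving the
  ancestors of the start vertex and the batch giving the descendants of the root; these cost the
  \<open>2 * n\<close> in \<open>b\<close>.\<close>

lemma fail_cover:
  fixes d t :: nat
  defines "n \<equiv> card (pverts G)"
  defines "b \<equiv> 2 * n + t * n + t * ((12 + d) * n)"
    and "\<rho> \<equiv> 2 + t + t * 4"
    and "\<gamma> \<equiv> (1 / 2) ^ t * real n + (1 - 1 / (512 * real d ^ 3)) ^ t * (real n)\<^sup>2"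
  assumes d: "1 \<le> d" and deg: "\<And>v. card {h. (v, h) \<in> parcs G} \<le> d"
    and U: "U \<subseteq> pverts G" "\<And>u w. u \<in> U \<Longrightarrow> w \<preceq> u \<Longrightarrow> w \<in> U"
    and E: "E = {(s, h) \<in> parcs G. s \<notin> U}"
    and m: "card (roots G \<inter> U) \<le> m"
  shows "fail (path_query G) (parcs G) (card (roots G \<inter> U) * b) (card (roots G \<inter> U) * \<rho>)
      (cover (pverts G) t m U E) \<le> real (card (roots G \<inter> U)) * \<gamma>"
proof -
  have c: "0 \<le> 1 - 1 / (512 * real d ^ 3)"
    using drop_rate_le_half[OF d] by simp
  have \<gamma>: "0 \<le> \<gamma>"
    using c by (simp add: \<gamma>_def)
  have finR: "finite (roots G \<inter> U)" for U
    using pair_finite_verts by (auto simp: roots_def)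
  show ?thesis
    using U E m
  proof (induction m arbitrary: U E)
    case 0
    then have no: "roots G \<inter> U = {}"
      using finR by simp
    have "U = {}"
    proof (rule ccontr)
      assume "U \<noteq> {}"
      then obtain v where "v \<in> U" by blast
      then obtain s where "s \<in> roots G" "s \<preceq> v"
        using root_exists 0(1) by blast
      then show False
        using no 0(2) \<open>v \<in> U\<close> by blast
    qed
    then have "E = parcs G"
      using 0(3) by auto
    then show ?case
      by (simp add: no)
  next
    case (Suc m)
    show ?case
    proof (cases "U = {}")
      case True
      then have "E = parcs G"
        using Suc.prems(3) by auto
      then show ?thesis
        by (simp add: True)
    next
      case False
      define v where "v = (SOME v. v \<in> U)"
      have v: "v \<in> U" "v \<in> pverts G"
        using some_in_eq[of U] False Suc.prems(1) by (auto simp: v_def)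
      define i where "i = card (roots G \<inter> U) - 1"
      have i: "card (roots G \<inter> U) = Suc i"
      proof -
        obtain s where "s \<in> roots G" "s \<preceq> v"
          using root_exists v by blast
        then have "roots G \<inter> U \<noteq> {}"
          using Suc.prems(2) v by blast
        then show ?thesis
          using finR by (simp add: i_def card_gt_0_iff)
      qed
      define \<beta> where "\<beta> = (1 - 1 / (512 * real d ^ 3)) ^ t * (real n)\<^sup>2 + real i * \<gamma>"
      define K where "K s = (\<lambda>Ps. cover (pverts G) t m (U - {u. s \<preceq> u}) (E \<union> arcs_of Ps))" for s
      have \<beta>: "0 \<le> \<beta>"
        using c \<gamma> by (simp add: \<beta>_def)
      have step: "fail (path_query G) (parcs G) (n + (t * ((12 + d) * n) + i * b)) (Suc (t * 4 + i * \<rho>))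
          (ask ({s} \<times> pverts G) (\<lambda>Y. learn t [(snd ` Y, {})]
            (\<lambda>Ps. cover (pverts G) t m (U - snd ` Y) (E \<union> arcs_of Ps)))) \<le> \<beta>"
        if s: "s \<in> roots G" "s \<preceq> v" for s
      proof -
        define D where "D = {u. s \<preceq> u}"
        have sG: "s \<in> pverts G"
          using s le_verts by blast
        have DG: "D \<subseteq> pverts G"
          using le_verts by (auto simp: D_def)
        have D: "card D \<le> n"
          unfolding n_def using DG by (rule card_mono[OF pair_finite_verts])
        have "valid_part (D, {})"
          using subtree_verts_below[OF sG] boundary_verts_below[of s] by (simp add: valid_part_def D_def)
        moreover have "fail (path_query G) (parcs G) (i * b) (i * \<rho>) (K s Ps) \<le> real i * \<gamma>"
          if Ps: "\<And>P. P \<in> set Ps \<Longrightarrow> valid_part P \<and> card (fst P) = 1" "(\<Union>P\<in>set Ps. fst P) = D" for Ps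
        proof -
          let ?U = "U - D"
          have "s \<in> roots G \<inter> U" "s \<in> D"
            using s Suc.prems(2) v le_refl[OF sG] by (auto simp: D_def)
          then have "roots G \<inter> ?U \<subset> roots G \<inter> U"
            by blast
          then have "card (roots G \<inter> ?U) < card (roots G \<inter> U)"
            by (rule psubset_card_mono[OF finR])
          then have le: "card (roots G \<inter> ?U) \<le> i"
            using i by simp
          have "fail (path_query G) (parcs G) (card (roots G \<inter> ?U) * b) (card (roots G \<inter> ?U) * \<rho>)
              (K s Ps) \<le> real (card (roots G \<inter> ?U)) * \<gamma>"
            unfolding K_def D_def[symmetric]
          proof (rule Suc.IH)
            show "?U \<subseteq> pverts G"
              using Suc.prems(1) by blast
            show "w \<in> ?U" if "u \<in> ?U" "w \<preceq> u" for u w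
              using that Suc.prems(2)[of u w] le_trans[of s w u] unfolding D_def by blast
            show "E \<union> arcs_of Ps = {(s, h) \<in> parcs G. s \<notin> ?U}"
            proof -
              have "arcs_of Ps = {(s, h) \<in> parcs G. s \<in> (\<Union>P\<in>set Ps. fst P)}"
                using Ps(1) by (rule arcs_of_singletons)
              then show ?thesis
                unfolding Ps(2) Suc.prems(3) by blast
            qed
            show "card (roots G \<inter> ?U) \<le> m"
              using le i Suc.prems(4) by simp
          qed
          moreover have "fail (path_query G) (parcs G) (i * b) (i * \<rho>) (K s Ps)
              \<le> fail (path_query G) (parcs G) (card (roots G \<inter> ?U) * b) (card (roots G \<inter> ?U) * \<rho>) (K s Ps)"
            using le by (intro fail_mono mult_le_mono1)
          moreover have "real (card (roots G \<inter> ?U)) * \<gamma> \<le> real i * \<gamma>"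
            using le \<gamma> by (intro mult_right_mono) auto
          ultimately show ?thesis by linarith
        qed
        ultimately have "fail (path_query G) (parcs G) (t * ((12 + d) * n) + i * b) (t * 4 + i * \<rho>)
            (learn t [(D, {})] (K s)) \<le> (1 - 1 / (512 * real d ^ 3)) ^ t * (\<Sum>P\<leftarrow>[(D, {})]. pot P) + real i * \<gamma>"
          using D \<gamma> by (intro fail_learn[OF d deg]) auto
        also have "\<dots> \<le> \<beta>"
        proof -
          have "pot (D, {}) \<le> real (card D) * real (card D)"
            unfolding pot_def fst_conv by (intro mult_left_mono) auto
          also have "\<dots> \<le> (real n)\<^sup>2"
            unfolding power2_eq_square using D by (intro mult_mono) auto
          finally show ?thesis
            using c unfolding \<beta>_def by (intro add_right_mono mult_left_mono) auto
        qed
        finally have *: "fail (path_query G) (parcs G) (t * ((12 + d) * n) + i * b) (t * 4 + i * \<rho>)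
            (learn t [(D, {})] (K s)) \<le> \<beta>" .
        show ?thesis
          by (rule order_trans[OF fail_ask])
            (use * pair_finite_verts in \<open>simp_all add: n_def card_cartesian_product descendants_query K_def D_def\<close>)
      qed
      define F where "F = (\<lambda>s. ask ({s} \<times> pverts G) (\<lambda>Y. learn t [(snd ` Y, {})]
            (\<lambda>Ps. cover (pverts G) t m (U - snd ` Y) (E \<union> arcs_of Ps))))"
      have "fail (path_query G) (parcs G) (card (roots G \<inter> U) * b) (card (roots G \<inter> U) * \<rho>)
          (cover (pverts G) t (Suc m) U E) =
        fail (path_query G) (parcs G) (n + (t * n + (n + (t * ((12 + d) * n) + i * b))))
          (Suc (t + Suc (t * 4 + i * \<rho>)))
          (ask (pverts G \<times> {v}) (\<lambda>X. find_root (pverts G) t v (fst ` X) F))"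
      proof -
        have "Suc i * b = n + (t * n + (n + (t * ((12 + d) * n) + i * b)))"
          by (simp add: b_def)
        moreover have "Suc i * \<rho> = Suc (t + Suc (t * 4 + i * \<rho>))"
          by (simp add: \<rho>_def)
        ultimately show ?thesis
          using False by (simp only: i cover.simps if_False v_def[symmetric] F_def[symmetric])
      qed
      also have "\<dots> \<le> fail (path_query G) (parcs G) (t * n + (n + (t * ((12 + d) * n) + i * b)))
          (t + Suc (t * 4 + i * \<rho>)) (find_root (pverts G) t v {u. u \<preceq> v} F)"
        unfolding ancestors_query[symmetric]
        using pair_finite_verts by (intro fail_ask) (simp_all add: n_def card_cartesian_product)
      also have "\<dots> \<le> (1 / 2) ^ t * (real (card {u. u \<preceq> v}) - 1) + \<beta>"
        unfolding n_def using v(2) \<beta> step by (intro fail_find_root) (simp_all add: F_def n_def)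
      also have "\<dots> \<le> (1 / 2) ^ t * real n + \<beta>"
      proof -
        have "{u. u \<preceq> v} \<subseteq> pverts G"
          using le_verts by blast
        then have "card {u. u \<preceq> v} \<le> n"
          unfolding n_def by (rule card_mono[OF pair_finite_verts])
        then show ?thesis
          by (intro add_right_mono mult_left_mono) auto
      qed
      also have "\<dots> = real (card (roots G \<inter> U)) * \<gamma>"
        by (simp add: i \<beta>_def \<gamma>_def algebra_simps)
      finally show ?thesis .
    qed
  qed
qed

end

text \<open>
  The potential drops by the factor \<open>1 - 1 / (512 * d ^ 3)\<close> per level, so this many levels bring
  it from \<open>n ^ 2\<close> below \<open>n ^ (-3)\<close>, small enough for a union bound over the roots.
\<close>

definition level_count :: "nat \<Rightarrow> nat \<Rightarrow> nat" where
  "level_count d n = nat \<lceil>2560 * real d ^ 3 * ln (real n)\<rceil>"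

section \<open>Number of levels and resulting constants\<close>

lemma half_le_ln2: "1 / 2 \<le> ln (2 :: real)"
proof -
  have "ln (1 / 2 :: real) \<le> 1 / 2 - 1"
    by (rule ln_le_minus_one) simp
  then show ?thesis
    by (simp add: ln_div)
qed

text \<open>Since \<open>ln n\<close> is at least one half, the rounding error of the ceiling is
  absorbed into a multiple of \<open>ln n\<close>.\<close>

lemma level_count_le:
  assumes "2 \<le> n"
  shows "1 \<le> 2 * ln (real n)" "real (level_count d n) \<le> (2560 * real d ^ 3 + 2) * ln (real n)"
proof -
  have "ln 2 \<le> ln (real n)"
    using assms by simp
  then show 1: "1 \<le> 2 * ln (real n)"
    using half_le_ln2 by linarith
  have "0 \<le> 2560 * real d ^ 3 * ln (real n)"
    using 1 by (intro mult_nonneg_nonneg) simp_all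
  then have "real (level_count d n) \<le> 2560 * real d ^ 3 * ln (real n) + 1"
    unfolding level_count_def using of_int_ceiling_le_add_one[of "2560 * real d ^ 3 * ln (real n)"] by simp
  also have "\<dots> \<le> 2560 * real d ^ 3 * ln (real n) + 2 * ln (real n)"
    using 1 by simp
  finally show "real (level_count d n) \<le> (2560 * real d ^ 3 + 2) * ln (real n)"
    by (simp add: algebra_simps)
qed

text \<open>The drop rate is at most one half, so the root search term decays at least as fast as
  the potential. Both are then controlled by
  \<open>n^(-5) * (n + n^2) <= n^(-5) * n^3\<close>.\<close>

lemma failure_rate_le:
  assumes n: "2 \<le> n" and d: "1 \<le> d"
  defines "t \<equiv> level_count d n"
  shows "(1 / 2) ^ t * real n + (1 - 1 / (512 * real d ^ 3)) ^ t * (real n)\<^sup>2 \<le> 1 / (real n)\<^sup>2"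
proof -
  define \<delta> where "\<delta> = 1 / (512 * real d ^ 3)"
  have \<delta>: "\<delta> \<le> 1 / 2" "0 < \<delta>"
    using drop_rate_le_half[OF d] d by (simp_all add: \<delta>_def)
  have "2560 * real d ^ 3 * ln (real n) \<le> real t"
    unfolding t_def level_count_def by (rule real_nat_ceiling_ge)
  then have "\<delta> * (2560 * real d ^ 3 * ln (real n)) \<le> \<delta> * real t"
    using \<delta> by (intro mult_left_mono) auto
  \<comment> \<open>The exponent 5 arises as \<open>2560 / 512\<close>.\<close>
  then have "exp (- (\<delta> * real t)) \<le> exp (- (5 * ln (real n)))"
    using d by (simp add: \<delta>_def)
  moreover have "(1 - \<delta>) ^ t \<le> exp (- \<delta>) ^ t"
    using \<delta> exp_ge_add_one_self[of "- \<delta>"] by (intro power_mono) auto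
  moreover have "exp (- \<delta>) ^ t = exp (- (\<delta> * real t))"
    by (simp add: exp_of_nat_mult[symmetric] mult.commute)
  ultimately have "(1 - \<delta>) ^ t \<le> exp (- (5 * ln (real n)))"
    by linarith
  also have "\<dots> = 1 / real n ^ 5"
    using n exp_of_nat_mult[of 5 "ln (real n)"] by (simp add: exp_minus field_simps)
  finally have rate: "(1 - \<delta>) ^ t \<le> 1 / real n ^ 5" .
  have "(1 / 2) ^ t \<le> (1 - \<delta>) ^ t"
    using \<delta> by (intro power_mono) auto
  then have "(1 / 2) ^ t * real n + (1 - \<delta>) ^ t * (real n)\<^sup>2 \<le> (1 - \<delta>) ^ t * (real n + (real n)\<^sup>2)"
    by (simp add: distrib_left mult_right_mono)
  also have "\<dots> \<le> 1 / real n ^ 5 * real n ^ 3"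
  proof (intro mult_mono rate)
    have "1 * real n + 2 * (real n)\<^sup>2 \<le> real n * real n + real n * (real n)\<^sup>2"
      using n by (intro add_mono mult_right_mono) auto
    then show "real n + (real n)\<^sup>2 \<le> real n ^ 3"
      by (simp add: power2_eq_square power3_eq_cube)
  qed auto
  also have "\<dots> = 1 / (real n)\<^sup>2"
    using n by (simp add: field_simps power_numeral_reduce)
  finally show ?thesis
    by (simp add: \<delta>_def)
qed

lemma (in multitree) card_out_neighbours_le:
  assumes "\<forall>v\<in>pverts G. vertex_degree G v \<le> d"
  shows "card {h. (v, h) \<in> parcs G} \<le> d"
proof (cases "v \<in> pverts G")
  case True
  have "{h. (v, h) \<in> parcs G} = snd ` out_arcs G v"
    by (force simp: out_arcs_def)
  moreover have "finite (out_arcs G v)"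
    using pair_finite_arcs by (simp add: out_arcs_def)
  ultimately have "card {h. (v, h) \<in> parcs G} \<le> out_degree G v"
    by (simp add: out_degree_def card_image_le)
  then show ?thesis
    using True assms by (fastforce simp: vertex_degree_def)
next
  case False
  then have "{h. (v, h) \<in> parcs G} = {}"
    by (auto dest: in_arcsD1)
  then show ?thesis by simp
qed

theorem theorem4:
  fixes d :: nat
  shows "\<exists>(alg :: 'a set \<Rightarrow> 'a query_alg) (Cq :: real) (Cr :: real) (c :: real).
    c \<ge> 1 \<and>
    (\<forall>(G :: 'a pair_pre_digraph) (n :: nat) (a :: nat).
       multitree G \<longrightarrow> pverts G \<noteq> {} \<longrightarrow> (\<forall>v \<in> pverts G. vertex_degree G v \<le> d) \<longrightarrow>
       n = card (pverts G) \<longrightarrow> a = card (roots G) \<longrightarrow>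
       measure_pmf.prob (run (path_query G) (alg (pverts G)))
         {(E, q, r). E = parcs G \<and>
            real q \<le> Cq * (real a * real n * ln (real n)) \<and>
            real r \<le> Cr * (real a * ln (real n))}
       \<ge> 1 - 1 / real n powr c)"
proof -
  \<comment> \<open>The successor makes \<open>D\<close> positive even for \<open>d = 0\<close>, so
    that the rate \<open>1 / (512 * D^3)\<close> is meaningful.\<close>
  define D where "D = Suc d"
  define K where "K = 2560 * real D ^ 3 + 2"
  \<comment> \<open>The \<open>4\<close> absorbs the two extra batches per root, because
    \<open>2 <= 4 * ln n\<close>. The factor \<open>13 + D\<close> adds one batch of root search to
    the \<open>12 + D\<close> of a level, and the \<open>5\<close> in \<open>Cr\<close> adds its one
    round to the four of a level.\<close>
  define Cq where "Cq = 4 + (13 + real D) * K"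
  define Cr where "Cr = 4 + 5 * K"
  define alg :: "'a set \<Rightarrow> 'a query_alg" where
    "alg V = cover V (level_count D (card V)) (card V) V {}" for V
  have "1 - 1 / real n powr 1 \<le> measure_pmf.prob (run (path_query G) (alg (pverts G)))
      {(E, q, r). E = parcs G \<and> real q \<le> Cq * (real a * real n * ln (real n)) \<and>
        real r \<le> Cr * (real a * ln (real n))}" (is "_ \<le> measure_pmf.prob ?M ?good")
    if G: "multitree G" and ne: "pverts G \<noteq> {}" and deg: "\<forall>v\<in>pverts G. vertex_degree G v \<le> d"
      and n: "n = card (pverts G)" and a: "a = card (roots G)"
    for G :: "'a pair_pre_digraph" and n a
  proof -
    interpret multitree G by fact
    have "n \<noteq> 0"
      using ne pair_finite_verts by (simp add: n)
    then consider "n = 1" | "2 \<le> n"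
      by linarith
    then show ?thesis
    proof cases
      \<comment> \<open>The logarithm vanishes here, but the claimed probability is then only
        \<open>1 - 1/1 = 0\<close>.\<close>
      case 1
      then show ?thesis by simp
    next
      case 2
      define t where "t = level_count D n"
      define b where "b = 2 * n + t * n + t * ((12 + D) * n)"
      define \<rho> where "\<rho> = 2 + t + t * 4"
      have D: "1 \<le> D" "\<And>v. card {h. (v, h) \<in> parcs G} \<le> D"
        using card_out_neighbours_le[OF deg] by (auto simp: D_def intro: le_SucI)
      have aR: "roots G \<inter> pverts G = roots G"
        by (auto simp: roots_def)
      have an: "a \<le> n"
        unfolding a n using pair_finite_verts by (intro card_mono) (auto simp: roots_def)
      have "fail (path_query G) (parcs G) (card (roots G \<inter> pverts G) * b) (card (roots G \<inter> pverts G) * \<rho>)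
          (cover (pverts G) t n (pverts G) {}) \<le> real (card (roots G \<inter> pverts G)) *
            ((1 / 2) ^ t * real n + (1 - 1 / (512 * real D ^ 3)) ^ t * (real n)\<^sup>2)"
        unfolding b_def \<rho>_def n
        using an le_verts by (intro fail_cover[OF D]) (auto simp: aR a n dest: in_arcsD1)
      \<comment> \<open>At most \<open>n\<close> roots, each contributing at most
        \<open>1 / n^2\<close>, give the exponent \<open>c = 1\<close>.\<close>
      also have "\<dots> \<le> real n * (1 / (real n)\<^sup>2)"
        using an failure_rate_le[OF 2 D(1)] drop_rate_le_half[OF D(1)]
        by (intro mult_mono) (auto simp: aR a t_def)
      also have "\<dots> = 1 / real n"
        by (simp add: power2_eq_square)
      finally have fail: "fail (path_query G) (parcs G) (a * b) (a * \<rho>) (alg (pverts G)) \<le> 1 / real n"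
        by (simp add: alg_def t_def aR a n)
      have K: "1 \<le> 2 * ln (real n)" "real t \<le> K * ln (real n)"
        using level_count_le[OF 2] by (simp_all add: K_def t_def)
      have "real b = real n * (2 + (13 + real D) * real t)"
        by (simp add: b_def algebra_simps)
      also have "\<dots> \<le> real n * (2 * (2 * ln (real n)) + (13 + real D) * (K * ln (real n)))"
        using K by (intro mult_left_mono add_mono) auto
      finally have "real b \<le> Cq * (real n * ln (real n))"
        by (simp add: Cq_def algebra_simps)
      then have "real a * real b \<le> real a * (Cq * (real n * ln (real n)))"
        by (rule mult_left_mono) simp
      then have q: "real (a * b) \<le> Cq * (real a * real n * ln (real n))"
        by (simp add: algebra_simps)
      have "real \<rho> \<le> Cr * ln (real n)"
        using K by (simp add: \<rho>_def Cr_def algebra_simps)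
      then have "real a * real \<rho> \<le> real a * (Cr * ln (real n))"
        by (rule mult_left_mono) simp
      then have r: "real (a * \<rho>) \<le> Cr * (real a * ln (real n))"
        by (simp add: algebra_simps)
      let ?bad = "{(E, q, r). \<not> (E = parcs G \<and> q \<le> a * b \<and> r \<le> a * \<rho>)}"
      have "1 - 1 / real n \<le> 1 - measure_pmf.prob ?M ?bad"
        using fail by (simp add: fail_def)
      also have "\<dots> = measure_pmf.prob ?M (- ?bad)"
        using measure_pmf.prob_compl[of ?bad ?M] by (simp add: Compl_eq_Diff_UNIV)
      also have "\<dots> \<le> measure_pmf.prob ?M ?good"
      proof (rule measure_pmf.finite_measure_mono)
        show "- ?bad \<subseteq> ?good"
        proof safe
          fix q' r'
          assume "q' \<le> a * b" "r' \<le> a * \<rho>"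
          then have "real q' \<le> real (a * b)" "real r' \<le> real (a * \<rho>)"
            by (simp_all only: of_nat_le_iff)
          then show "real q' \<le> Cq * (real a * real n * ln (real n))" "real r' \<le> Cr * (real a * ln (real n))"
            using q r by linarith+
        qed
      qed simp
      finally show ?thesis
        using 2 by simp
    qed
  qed
  then show ?thesis
    by (intro exI[of _ alg] exI[of _ Cq] exI[of _ Cr] exI[of _ 1]) auto
qed

end
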